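(* Let $N$ be a free $\mathbf Z$-module of finite rank with basis $(\lambda_i)_{i\in I}$, $\Lambda\subset N_{\mathbf R}$ the cone generated by this basis, $M\subset N$ a subgroup such that $\Gamma=N/M$ is torsion-free, $j:N\to\Gamma$ the quotient map, and $N'\subset N$ a subgroup of finite index. Let $\widetilde I\subsetneq I$ be a strict subset and $\widetilde\Lambda\subset\Lambda$ the cone generated by $(\lambda_i)_{i\in\widetilde I}$. Let $a:\Lambda\cap N\to\mathbf C$ and $\varepsilon>0$ be such that the series defining $\mathcal L_{N,\Lambda,a}(q^{-s})$ converges absolutely for all $s\in\mathcal T(\Lambda^\vee_{>-\varepsilon})$. For $s\in\mathcal T(\Lambda^\vee_{>0})$ put $$f_3(s)=\int_{\Gamma^\vee_{\mathbf U}}\mathcal L_{N,\Lambda,a}\bigl(j^\vee_{\mathbf U}(z)\,q^{-s}\bigr)\,\mathcal L_{N',\widetilde\Lambda}\bigl(j^\vee_{\mathbf U}(z)\,q^{-s}\bigr)\,dz .$$ Assume $\Gamma^\vee\cap\Lambda^\vee=\{0\}$. Then $f_3$ is admissible of multiplicity at least $1-\mathrm{rk}(M)$.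
   Context: $q$ is the cardinality of a fixed finite field. For a $\mathbf Z$-module $N$ write $N^\vee=\mathrm{Hom}(N,\mathbf Z)$, $N_A=N\otimes A$. $(\lambda_i^\vee)$ is the basis dual to $(\lambda_i)$; $\Lambda^\vee\subset N^\vee_{\mathbf R}$ is the dual cone of $\Lambda$; for real $\eta$, $\Lambda^\vee_{>\eta}=\sum_{i\in I}\mathbf R_{>\eta}\lambda_i^\vee$; for $U\subset N^\vee_{\mathbf R}$, $\mathcal T(U)=\{s\in N^\vee_{\mathbf C}:\Re(s)\in U\}$. $\mathbf U$ is the group of complex numbers of modulus $1$; $N^\vee_{\mathbf U}=\mathrm{Hom}(N,\mathbf U)$, $N^\vee_{\mathbf C^\times}=\mathrm{Hom}(N,\mathbf C^\times)$, with pairing $\langle z,y\rangle=z(y)$. For $s\in N^\vee_{\mathbf C}$, $q^{-s}\in N^\vee_{\mathbf C^\times}$ is $y\mapsto q^{-\langle y,s\rangle}$. For $A\subset N_{\mathbf R}$ and $a:A\cap N\to\mathbf C$, $\mathcal L_{N,A,a}(z)=\sum_{y\in A\cap N}a_y\langle z,y\rangle$ for those $z\in N^\vee_{\mathbf C^\times}$ for which this converges absolutely. For a subgroup $N'\subset N$, $\mathcal L_{N',A}(z)=\sum_{y\in A\cap N'}\langle z,y\rangle$. $j^\vee:\Gamma^\vee\hookrightarrow N^\vee$ is dual to $j$ (through it $\Gamma^\vee$ is viewed inside $N^\vee$); $j^\vee_{\mathbf U}:\Gamma^\vee_{\mathbf U}\to N^\vee_{\mathbf U}$ is the induced map; $dz$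 is the Haar measure of total mass $1$ on $\Gamma^\vee_{\mathbf U}$. Admissible functions. An elementary admissible function of multiplicity at least $0$ is a function $s\mapsto\mathcal L_{N,\Lambda,b}(q^{-s})$ where $b:\Lambda\cap N\to\mathbf C$ is such that for some $\eta>0$ the series converges absolutely for all $s\in\mathcal T(\Lambda^\vee_{>-\eta})$. For an integer $r\ge1$, an elementary admissible function of multiplicity at least $-r$ is a holomorphic function $f$ on $\mathcal T(\Lambda^\vee_{>0})$ that can be written $f(s)=g(s)\,\mathcal L_{N'',\mathrm{relint}(\Upsilon)}(q^{-s})$ with $\Upsilon\subset\Lambda$ a (rational polyhedral) cone of dimension at most $r$, $\mathrm{relint}(\Upsilon)$ its relative interior, $N''$ a subgroup of $N$, and $g$ elementary admissible of multiplicity at least $0$. For $r\ge0$, a function admissible of multiplicity at least $-r$ is a finite sum of elementary admissible functions of multiplicity at least $-r$. *)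

theory Defs
  imports "HOL-Analysis.Analysis" "HOL-Algebra.Elementary_Groups"
begin

text \<open>
  A free module of finite rank with a chosen basis indexed by \<open>I\<close> is \<open>\<int>\<^sup>I\<close>: the index set is
  the finite type \<open>'i\<close>, \<open>N\<close> is the type \<open>int ^ 'i\<close> and \<open>\<lambda>\<^sub>i\<close> is \<open>axis i 1\<close>. Accordingly
  \<open>N\<^sub>\<real>\<close> is \<open>real ^ 'i\<close>, and \<open>Hom(N, \<real>)\<close> and \<open>Hom(N, \<complex>)\<close> are \<open>real ^ 'i\<close> and
  \<open>complex ^ 'i\<close> in the coordinates given by the dual basis. The multiplicative duals
  \<open>Hom(N, U)\<close> and \<open>Hom(N, \<complex>\<^sup>\<times>)\<close> are kept as functions on \<open>N\<close>, so that the pairing of \<open>z\<close> and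
  \<open>y\<close> is \<open>z y\<close>.
\<close>

subsection \<open>The lattice, its quotients and their duals\<close>

definition Ngrp :: "(int ^ 'i) monoid" where
  "Ngrp = \<lparr>carrier = UNIV, monoid.mult = (+), one = 0\<rparr>"

definition Ugrp :: "complex monoid" where
  "Ugrp = \<lparr>carrier = {z. cmod z = 1}, monoid.mult = (*), one = 1\<rparr>"

definition in_NR :: "int ^ 'i \<Rightarrow> real ^ 'i" where
  "in_NR y = (\<chi> i. of_int (y $ i))"

definition quot_map :: "(int ^ 'i) set \<Rightarrow> int ^ 'i \<Rightarrow> (int ^ 'i) set" where
  "quot_map M y = M #>\<^bsub>Ngrp\<^esub> y"

definition torsion_free_group :: "('a, 'b) monoid_scheme \<Rightarrow> bool" where
  "torsion_free_group G \<longleftrightarrow>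
     (\<forall>x\<in>carrier G. \<forall>n::nat. 0 < n \<longrightarrow> x [^]\<^bsub>G\<^esub> n = \<one>\<^bsub>G\<^esub> \<longrightarrow> x = \<one>\<^bsub>G\<^esub>)"

definition finite_index :: "(int ^ 'i) set \<Rightarrow> bool" where
  "finite_index H \<longleftrightarrow> subgroup H Ngrp \<and> finite (rcosets\<^bsub>Ngrp\<^esub> H)"

text \<open>
  The rank of \<open>M\<close> is the real dimension of \<open>M\<^sub>\<real> = M \<otimes> \<real>\<close>; by flatness of \<open>\<real>\<close> this
  is the subspace of \<open>N\<^sub>\<real>\<close> spanned by \<open>M\<close>.
\<close>

definition subgroup_rank :: "(int ^ 'i) set \<Rightarrow> nat" where
  "subgroup_rank M = dim (span (in_NR ` M))"

text \<open>\<open>\<Gamma>\<^sup>\<or> = Hom(N/M, \<int>)\<close>, viewed in \<open>Hom(N, \<real>)\<close> by composition with the quotient map.\<close>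

definition dual_quot :: "(int ^ 'i) set \<Rightarrow> (real ^ 'i) set" where
  "dual_quot M =
     {(\<chi> i. of_int (\<phi> (quot_map M (axis i 1)))) |\<phi>. \<phi> \<in> hom (Ngrp Mod M) integer_group}"

text \<open>
  Elements of \<open>Hom(N/M, U)\<close> are functions on cosets, made unique by extensionality.
\<close>

definition unitary_dual :: "(int ^ 'i) set \<Rightarrow> ((int ^ 'i) set \<Rightarrow> complex) set" where
  "unitary_dual M = hom (Ngrp Mod M) Ugrp \<inter> extensional (carrier (Ngrp Mod M))"

text \<open>
  The group \<open>N/M\<close> is countable and discrete, so the Borel sets of \<open>Hom(N/M, U)\<close> (topology of
  pointwise convergence) are the traces of the product Borel \<open>\<sigma>\<close>-algebra.
\<close>

definition normalized_haar ::
    "(int ^ 'i) set \<Rightarrow> ((int ^ 'i) set \<Rightarrow> complex) measure \<Rightarrow> bool" where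
  "normalized_haar M \<mu> \<longleftrightarrow>
     space \<mu> = unitary_dual M \<and>
     sets \<mu> = sets (restrict_space (\<Pi>\<^sub>M c\<in>carrier (Ngrp Mod M). borel) (unitary_dual M)) \<and>
     emeasure \<mu> (space \<mu>) = 1 \<and>
     (\<forall>w\<in>unitary_dual M. distr \<mu> \<mu> (\<lambda>z. \<lambda>c\<in>carrier (Ngrp Mod M). w c * z c) = \<mu>)"

subsection \<open>Cones and tubes\<close>

definition cone_gen :: "(int ^ 'i) set \<Rightarrow> (real ^ 'i) set" where
  "cone_gen S = convex_cone hull (in_NR ` S)"

definition rational_polyhedral_cone :: "(real ^ 'i) set \<Rightarrow> bool" where
  "rational_polyhedral_cone C \<longleftrightarrow> (\<exists>S. finite S \<and> C = cone_gen S)"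

definition Lam :: "(real ^ 'i) set" where
  "Lam = cone_gen (range (\<lambda>i. axis i 1))"

definition dual_cone :: "(real ^ 'i) set \<Rightarrow> (real ^ 'i) set" where
  "dual_cone C = {x. \<forall>y\<in>C. 0 \<le> x \<bullet> y}"

definition Lam_dual_gt :: "real \<Rightarrow> (real ^ 'i) set" where
  "Lam_dual_gt \<eta> = {x. \<forall>i. \<eta> < x $ i}"

definition tube :: "(real ^ 'i) set \<Rightarrow> (complex ^ 'i) set" where
  "tube U = {s. (\<chi> i. Re (s $ i)) \<in> U}"

subsection \<open>Laurent series\<close>

definition qpow :: "nat \<Rightarrow> complex ^ 'i \<Rightarrow> int ^ 'i \<Rightarrow> complex" where
  "qpow q s y = of_nat q powr (- (\<Sum>i\<in>UNIV. of_int (y $ i) * s $ i))"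

definition lattice_pts :: "(int ^ 'i) set \<Rightarrow> (real ^ 'i) set \<Rightarrow> (int ^ 'i) set" where
  "lattice_pts H A = {y \<in> H. in_NR y \<in> A}"

definition Lser_converges ::
    "(int ^ 'i) set \<Rightarrow> (real ^ 'i) set \<Rightarrow> (int ^ 'i \<Rightarrow> complex) \<Rightarrow> (int ^ 'i \<Rightarrow> complex) \<Rightarrow> bool" where
  "Lser_converges H A a z \<longleftrightarrow> (\<lambda>y. norm (a y * z y)) summable_on lattice_pts H A"

text \<open>The values of \<open>a\<close> outside \<open>A \<inter> H\<close> play no role.\<close>

definition Lser ::
    "(int ^ 'i) set \<Rightarrow> (real ^ 'i) set \<Rightarrow> (int ^ 'i \<Rightarrow> complex) \<Rightarrow> (int ^ 'i \<Rightarrow> complex) \<Rightarrow> complex" where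
  "Lser H A a z = (\<Sum>\<^sub>\<infinity>y\<in>lattice_pts H A. a y * z y)"

subsection \<open>Admissible functions\<close>

text \<open>
  Holomorphy in several variables: the real Frechet derivative exists and is complex linear at
  every point of the (open) set.
\<close>

definition holomorphic_several :: "(complex ^ 'i \<Rightarrow> complex) \<Rightarrow> (complex ^ 'i) set \<Rightarrow> bool" where
  "holomorphic_several f S \<longleftrightarrow>
     (\<forall>s\<in>S. \<exists>D. (f has_derivative D) (at s) \<and> (\<forall>c v. D (c *s v) = c * D v))"

text \<open>
  Admissible functions are regarded as functions on the tube over \<open>Lam_dual_gt 0\<close>; the values
  elsewhere of the total functions representing them are irrelevant.
\<close>

definition elementary_admissible_0 :: "nat \<Rightarrow> (complex ^ 'i \<Rightarrow> complex) \<Rightarrow> bool" where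
  "elementary_admissible_0 q f \<longleftrightarrow>
     (\<exists>b. (\<exists>\<eta>>0. \<forall>s\<in>tube (Lam_dual_gt (- \<eta>)). Lser_converges UNIV Lam b (qpow q s)) \<and>
          (\<forall>s\<in>tube (Lam_dual_gt 0). f s = Lser UNIV Lam b (qpow q s)))"

definition elementary_admissible_pos :: "nat \<Rightarrow> nat \<Rightarrow> (complex ^ 'i \<Rightarrow> complex) \<Rightarrow> bool" where
  "elementary_admissible_pos q r f \<longleftrightarrow>
     holomorphic_several f (tube (Lam_dual_gt 0)) \<and>
     (\<exists>g \<Upsilon> N''. elementary_admissible_0 q g \<and>
        rational_polyhedral_cone \<Upsilon> \<and> \<Upsilon> \<subseteq> Lam \<and> dim \<Upsilon> \<le> r \<and> subgroup N'' Ngrp \<and>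
        (\<forall>s\<in>tube (Lam_dual_gt 0).
           f s = g s * Lser N'' (rel_interior \<Upsilon>) (\<lambda>_. 1) (qpow q s)))"

text \<open>Elementary admissible of multiplicity at least \<open>- r\<close>.\<close>

definition elementary_admissible :: "nat \<Rightarrow> nat \<Rightarrow> (complex ^ 'i \<Rightarrow> complex) \<Rightarrow> bool" where
  "elementary_admissible q r f \<longleftrightarrow>
     (if r = 0 then elementary_admissible_0 q f else elementary_admissible_pos q r f)"

text \<open>
  Admissible of multiplicity at least \<open>m\<close>. The notion only exists for \<open>m = - r\<close> with \<open>r\<close> a
  natural number; for positive \<open>m\<close> the predicate is false.
\<close>

definition admissible :: "nat \<Rightarrow> int \<Rightarrow> (complex ^ 'i \<Rightarrow> complex) \<Rightarrow> bool" where
  "admissible q m f \<longleftrightarrow>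
     (\<exists>r::nat. m = - int r \<and>
       (\<exists>(K::nat) F. (\<forall>k<K. elementary_admissible q r (F k)) \<and>
          (\<forall>s\<in>tube (Lam_dual_gt 0). f s = (\<Sum>k<K. F k s))))"

end

theory Submission
  imports Defs "HOL-Algebra.Multiplicative_Group"
begin

text \<open>
  Write $y$ for a lattice point of $\Lambda$ and $x$ for a point of $N' \cap \widetilde\Lambda$.
  Expanding both Laurent series and integrating over the characters of $\Gamma = N/M$ leaves
  the pairs with $y + x \in M$ (orthogonality, \<open>haar_orthogonality\<close>), so
  $$f_3(s) = G(N' \cap \widetilde\Lambda)(s), \qquad
    G(X)(s) = \sum_{y,\ x \in X,\ y + x \in M} a_y q^{-\langle y + x, s\rangle}.$$
  The problem is to separate the directions in which $x$ can run off to infinity while $y$ stays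
  bounded, namely those of $M \cap \widetilde\Lambda$, from all the others.

  Choose $d > 0$ with $dN \subset N'$. Then $N' \cap \widetilde\Lambda$ is a finite disjoint
  union of boxes $v + d\,\mathbf N^K$, with $K = \widetilde I$, and each box is treated by
  induction on the number of its free coordinates (\<open>G_cone_sum\<close>).

  If $M$ meets $d\,\mathbf N^K$ only in $0$, a form of Dickson's lemma bounds the size of $x$
  linearly by that of $y$ for all pairs with $y + x \in M$ (\<open>height_bound\<close>). The absolute
  convergence of the series of $a$ slightly to the left of the tube is therefore inherited by
  $G$, which is elementary admissible of multiplicity at least $0$ (\<open>G_transversal\<close>).

  Otherwise pick a nonzero $p \in M \cap d\,\mathbf N^K$. Translating the box by $p$
  multiplies $G$ by $Q_p = q^{-\langle p, s\rangle}$, because $p \in M$; and the box minus its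
  translate is a finite disjoint union of boxes in which a coordinate $c$ with $p_c \neq 0$ has
  been frozen. So $(1 - Q_p)\,G$ is a finite sum of functions known by induction, and
  $1/(1 - Q_p) = 1 + Q_p/(1 - Q_p)$. The generators that come from the smaller boxes vanish at
  $c$ while $p$ does not, so linear independence is preserved.

  In the end $f_3$ is a finite sum of terms $g \cdot \prod_{p \in F} Q_p/(1 - Q_p)$ with $g$
  elementary admissible of multiplicity at least $0$ and $F \subset M \cap \widetilde\Lambda$
  linearly independent. The product is the Laurent series of the lattice generated by $F$ over the
  relative interior of the simplicial cone on $F$ (\<open>cone_prod_series\<close>,
  \<open>lattice_pts_rel_interior\<close>). The condition on $\Gamma^\vee \cap \Lambda^\vee$ says in
  particular that no coordinate form $\lambda_c^\vee$ vanishes on $M$. For $c \notin \widetilde I$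
  this form vanishes on $F$, so $F$ spans a proper subspace of $M_{\mathbf R}$ and has at most
  $\mathrm{rk}(M) - 1$ elements.
\<close>

section \<open>Lattice points of the orthant and Laurent series\<close>

text \<open>
  The symbol is ambiguous between the two theories of unordered sums; here it refers to
  summability of the norms.
\<close>

no_notation Infinite_Set_Sum.abs_summable_on (infix \<open>abs'_summable'_on\<close> 50)

definition orthant :: "'i set \<Rightarrow> (int ^ 'i) set" where
  "orthant K = {x. (\<forall>i. 0 \<le> x $ i) \<and> (\<forall>i. i \<notin> K \<longrightarrow> x $ i = 0)}"

lemma orthantD: "x \<in> orthant K \<Longrightarrow> 0 \<le> x $ i" "x \<in> orthant K \<Longrightarrow> i \<notin> K \<Longrightarrow> x $ i = 0"
  by (auto simp: orthant_def)

lemma orthant_0 [simp]: "0 \<in> orthant K"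
  by (simp add: orthant_def)

lemma orthant_add: "x \<in> orthant K \<Longrightarrow> y \<in> orthant K \<Longrightarrow> x + y \<in> orthant K"
  by (simp add: orthant_def)

lemma orthant_mono: "K \<subseteq> L \<Longrightarrow> orthant K \<subseteq> orthant L"
  by (auto simp: orthant_def)

lemma in_NR_nth [simp]: "in_NR x $ i = of_int (x $ i)"
  by (simp add: in_NR_def)

lemma in_NR_add: "in_NR (x + y) = in_NR x + in_NR y"
  and in_NR_0 [simp]: "in_NR 0 = 0"
  and in_NR_scale: "in_NR (n *s x) = of_int n *\<^sub>R in_NR x"
  by (simp_all add: vec_eq_iff)

lemma in_NR_sum: "in_NR (sum f A) = (\<Sum>x\<in>A. in_NR (f x))"
  by (induction A rule: infinite_finite_induct) (auto simp: in_NR_add)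

lemma inj_in_NR: "inj in_NR"
  by (auto simp: inj_def vec_eq_iff)

lemma in_NR_axis: "in_NR (axis i 1) = axis i 1"
  by (auto simp: vec_eq_iff axis_def)

definition height :: "int ^ 'i \<Rightarrow> int" where
  "height x = (\<Sum>i\<in>UNIV. x $ i)"

lemma height_add: "height (x + y) = height x + height y"
  by (simp add: height_def sum.distrib)

lemma height_scale: "height (d *s x) = d * height x"
  by (simp add: height_def sum_distrib_left)

lemma height_nonneg: "x \<in> orthant K \<Longrightarrow> 0 \<le> height x"
  by (auto simp: height_def orthant_def intro: sum_nonneg)

lemma coordinate_cone: "cone_gen ((\<lambda>i. axis i 1) ` J) = {x. (\<forall>i. 0 \<le> x $ i) \<and> (\<forall>i. i \<notin> J \<longrightarrow> x $ i = 0)}"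
  (is "_ = ?C")
  unfolding cone_gen_def
proof (rule hull_unique)
  show "in_NR ` (\<lambda>i. axis i 1) ` J \<subseteq> ?C"
    by (auto simp: in_NR_axis axis_def)
  show "convex_cone ?C"
    by (auto simp: convex_cone_iff)
  fix T assume T: "in_NR ` (\<lambda>i. axis i 1) ` J \<subseteq> T" "convex_cone T"
  show "?C \<subseteq> T"
  proof
    fix x assume x: "x \<in> ?C"
    have sub: "(\<Sum>i\<in>A. x $ i *\<^sub>R axis i 1) \<in> T" for A :: "'a set"
    proof (induction A rule: infinite_finite_induct)
      case (insert i A)
      have "x $ i *\<^sub>R axis i 1 \<in> T"
      proof (cases "i \<in> J")
        case True
        hence "in_NR (axis i 1) \<in> T" using T(1) by blast
        hence "axis i 1 \<in> T" by (simp add: in_NR_axis)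
        thus ?thesis using T(2) x by (intro convex_cone_scaleR) auto
      next
        case False
        thus ?thesis using x T(2) by (simp add: convex_cone_contains_0)
      qed
      thus ?case using insert T(2) by (simp add: convex_cone_add)
    qed (use T(2) in \<open>auto simp: convex_cone_contains_0\<close>)
    have "x = (\<Sum>i\<in>UNIV. x $ i *\<^sub>R axis i 1)"
      by (simp add: vec_eq_iff axis_def if_distrib cong: if_cong)
    thus "x \<in> T" using sub[of UNIV] by simp
  qed
qed

lemma lattice_pts_coordinate: "lattice_pts H (cone_gen ((\<lambda>i. axis i 1) ` J)) = H \<inter> orthant J"
  by (auto simp: lattice_pts_def coordinate_cone orthant_def)

lemma lattice_pts_Lam: "lattice_pts UNIV Lam = orthant UNIV"
  using lattice_pts_coordinate[of UNIV UNIV] by (simp add: Lam_def)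

lemma qpow_add: "q > 0 \<Longrightarrow> qpow q s (x + y) = qpow q s x * qpow q s y"
  by (simp add: qpow_def powr_add[symmetric] sum_negf distrib_right sum.distrib)

lemma qpow_0 [simp]: "q > 0 \<Longrightarrow> qpow q s 0 = 1"
  by (simp add: qpow_def)

lemma norm_qpow: "q > 0 \<Longrightarrow> norm (qpow q s x) = real q powr (- (\<Sum>i\<in>UNIV. of_int (x $ i) * Re (s $ i)))"
  by (simp add: qpow_def norm_powr_real_powr Re_sum)

lemma norm_qpow_const:
  assumes "q > 0"
  shows "norm (qpow q (\<chi> i. of_real c) x) = real q powr (- (c * of_int (height x)))"
proof -
  have "(\<Sum>i\<in>UNIV. of_int (x $ i) * c) = c * of_int (height x)"
    by (simp add: height_def sum_distrib_left mult.commute)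
  thus ?thesis using assms by (simp add: norm_qpow)
qed

lemma norm_qpow_mono:
  assumes "q > 0" "x \<in> orthant UNIV" "\<And>i. Re (s $ i) \<le> Re (t $ i)"
  shows "norm (qpow q t x) \<le> norm (qpow q s x)"
  using assms by (auto simp: norm_qpow orthant_def intro!: powr_mono sum_mono mult_left_mono)

lemma tube_gt: "s \<in> tube (Lam_dual_gt \<eta>) \<longleftrightarrow> (\<forall>i. \<eta> < Re (s $ i))"
  by (simp add: tube_def Lam_dual_gt_def)

lemma tube_gt_mono: "\<eta> \<le> \<eta>' \<Longrightarrow> tube (Lam_dual_gt \<eta>') \<subseteq> tube (Lam_dual_gt \<eta>)"
  unfolding subset_iff tube_gt by (meson le_less_trans)

lemma norm_qpow_lt_1:
  assumes "q > 1" "x \<in> orthant UNIV" "x \<noteq> 0" "s \<in> tube (Lam_dual_gt 0)"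
  shows "norm (qpow q s x) < 1"
proof -
  obtain i where i: "x $ i \<noteq> 0" using assms by (auto simp: vec_eq_iff)
  have "0 < (\<Sum>i\<in>UNIV. of_int (x $ i) * Re (s $ i))"
    using assms i by (intro sum_pos2[where i=i]) (auto simp: orthant_def tube_gt less_le intro!: mult_nonneg_nonneg)
  thus ?thesis using assms by (simp add: norm_qpow powr_less_one)
qed

lemma Lser_converges_Lam:
  "Lser_converges UNIV Lam b z \<longleftrightarrow> (\<lambda>y. b y * z y) abs_summable_on orthant UNIV"
  by (simp add: Lser_converges_def lattice_pts_Lam)

lemma Lser_Lam: "Lser UNIV Lam b z = (\<Sum>\<^sub>\<infinity>y\<in>orthant UNIV. b y * z y)"
  by (simp add: Lser_def lattice_pts_Lam)

text \<open>
  On the tube the series is a product, over the coordinates, of convergent geometric series.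
\<close>

lemma summable_qpow:
  assumes "q > 1" "s \<in> tube (Lam_dual_gt 0)"
  shows "qpow q s abs_summable_on orthant UNIV"
proof -
  define t where "t i = real q powr (- Re (s $ i))" for i
  have t: "0 < t i" "t i < 1" for i
    using assms by (auto simp: t_def tube_gt powr_less_one)
  have "Infinite_Set_Sum.abs_summable_on (\<lambda>n. t i ^ n) UNIV" for i
    using t[of i] unfolding abs_summable_on_nat_iff' by (simp add: abs_of_pos)
  hence "Infinite_Set_Sum.abs_summable_on (\<lambda>g. \<Prod>i\<in>UNIV. t i ^ (g i)) (PiE UNIV (\<lambda>_::'a. UNIV :: nat set))"
    by (intro abs_summable_on_prod_PiE) auto
  hence 1: "(\<lambda>g. \<Prod>i\<in>UNIV. t i ^ (g i)) abs_summable_on (PiE UNIV (\<lambda>_::'a. UNIV :: nat set))"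
    by (simp only: abs_summable_equivalent[symmetric])
  have eq: "norm (qpow q s x) = norm (\<Prod>i\<in>UNIV. t i ^ nat (x $ i))" if "x \<in> orthant UNIV" for x
  proof -
    have "norm (qpow q s x) = (\<Prod>i\<in>UNIV. real q powr (of_int (x $ i) * - Re (s $ i)))"
      using assms by (simp add: norm_qpow powr_sum sum_negf[symmetric])
    also have "\<dots> = (\<Prod>i\<in>UNIV. t i ^ nat (x $ i))"
    proof (rule prod.cong, rule refl)
      fix i
      have "0 \<le> x $ i" using that by (auto simp: orthant_def)
      thus "real q powr (of_int (x $ i) * - Re (s $ i)) = t i ^ nat (x $ i)"
        using assms t[of i]
        by (simp add: t_def powr_powr mult.commute flip: powr_realpow)
    qed
    also have "\<dots> = norm \<dots>"
      using t by (simp add: abs_prod power_abs abs_of_pos)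
    finally show ?thesis .
  qed
  have bij: "bij_betw (\<lambda>x i. nat (x $ i)) (orthant UNIV) (PiE UNIV (\<lambda>_::'a. UNIV :: nat set))"
    by (rule bij_betw_byWitness[where f'="\<lambda>g. \<chi> i. int (g i)"]) (auto simp: orthant_def vec_eq_iff)
  have "(\<lambda>x. norm (\<Prod>i\<in>UNIV. t i ^ nat (x $ i))) summable_on orthant UNIV"
    using 1 summable_on_reindex_bij_betw[OF bij, of "\<lambda>g. norm (\<Prod>i\<in>UNIV. t i ^ (g i))"] by simp
  thus ?thesis
    by (rule summable_on_cong[THEN iffD1, rotated]) (simp add: eq)
qed

text \<open>
  Regrouping turns any absolutely convergent family of multiples of characters $q^{-s}$ into a
  Laurent series. The new coefficients are sums over the fibres of the exponent map, so their
  absolute values are dominated by the sums of the absolute values, and convergence at a point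
  is inherited without loss.
\<close>

lemma group_by_exponent:
  fixes W :: "'w set" and c :: "'w \<Rightarrow> complex" and h :: "'w \<Rightarrow> int ^ 'i"
  defines "b \<equiv> \<lambda>m. \<Sum>\<^sub>\<infinity>w\<in>{w\<in>W. h w = m}. c w"
  assumes h: "h ` W \<subseteq> orthant UNIV"
    and sm: "(\<lambda>w. c w * qpow q s (h w)) abs_summable_on W" and q: "q > 0"
  shows "Lser_converges UNIV Lam b (qpow q s)"
    and "Lser UNIV Lam b (qpow q s) = (\<Sum>\<^sub>\<infinity>w\<in>W. c w * qpow q s (h w))"
proof -
  define B where "B m = {w\<in>W. h w = m}" for m
  have bij: "bij_betw snd (Sigma (orthant UNIV) B) W"
    by (rule bij_betw_byWitness[where f'="\<lambda>w. (h w, w)"]) (use h in \<open>auto simp: B_def\<close>)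
  have S: "(\<lambda>u. c (snd u) * qpow q s (h (snd u))) abs_summable_on Sigma (orthant UNIV) B"
    using summable_on_reindex_bij_betw[OF bij, of "\<lambda>w. norm (c w * qpow q s (h w))"] sm by simp
  have b: "(\<Sum>\<^sub>\<infinity>w\<in>B m. c w * qpow q s (h w)) = b m * qpow q s m" for m
  proof -
    have "(\<Sum>\<^sub>\<infinity>w\<in>B m. c w * qpow q s (h w)) = (\<Sum>\<^sub>\<infinity>w\<in>B m. c w * qpow q s m)"
      by (rule infsum_cong) (auto simp: B_def)
    thus ?thesis by (simp add: infsum_cmult_left' b_def B_def)
  qed
  have n: "(\<Sum>\<^sub>\<infinity>w\<in>B m. norm (c w * qpow q s (h w))) \<ge> norm (b m * qpow q s m)"
    if "m \<in> orthant UNIV" for m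
    unfolding b[symmetric]
    by (intro norm_infsum_bound summable_on_subset_banach[OF sm]) (auto simp: B_def)
  have "(\<lambda>m. \<Sum>\<^sub>\<infinity>w\<in>B m. norm (c w * qpow q s (h w))) abs_summable_on orthant UNIV"
    using Infinite_Sum.abs_summable_on_Sigma_iff[THEN iffD1, OF S] by simp
  hence "(\<lambda>m. b m * qpow q s m) abs_summable_on orthant UNIV"
    by (rule Infinite_Sum.abs_summable_on_comparison_test) (use n in \<open>auto intro: order_trans[OF n abs_ge_self]\<close>)
  thus "Lser_converges UNIV Lam b (qpow q s)"
    by (simp add: Lser_converges_Lam)
  have "(\<Sum>\<^sub>\<infinity>w\<in>W. c w * qpow q s (h w)) = (\<Sum>\<^sub>\<infinity>u\<in>Sigma (orthant UNIV) B. c (snd u) * qpow q s (h (snd u)))"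
    using infsum_reindex_bij_betw[OF bij, of "\<lambda>w. c w * qpow q s (h w)"] by simp
  also have "\<dots> = (\<Sum>\<^sub>\<infinity>m\<in>orthant UNIV. \<Sum>\<^sub>\<infinity>w\<in>B m. c w * qpow q s (h w))"
    using S by (subst infsum_Sigma_banach[symmetric]) (auto intro: abs_summable_summable)
  finally show "Lser UNIV Lam b (qpow q s) = (\<Sum>\<^sub>\<infinity>w\<in>W. c w * qpow q s (h w))"
    by (simp add: Lser_Lam b)
qed

lemma abs_summable_on_Times:
  fixes f :: "'a \<Rightarrow> complex" and g :: "'b \<Rightarrow> complex"
  assumes "f abs_summable_on A" "g abs_summable_on B"
  shows "(\<lambda>(x, y). f x * g y) abs_summable_on A \<times> B"
proof (rule Infinite_Sum.abs_summable_on_Sigma_iff[THEN iffD2], intro conjI ballI)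
  show "(\<lambda>y. case (x, y) of (x, y) \<Rightarrow> f x * g y) abs_summable_on B" for x
    using summable_on_cmult_right[OF assms(2), of "norm (f x)"] by (simp add: norm_mult)
  have "(\<lambda>x. norm (f x) * (\<Sum>\<^sub>\<infinity>y\<in>B. norm (g y))) summable_on A"
    using assms(1) by (intro summable_on_cmult_left)
  thus "(\<lambda>x. \<Sum>\<^sub>\<infinity>y\<in>B. norm (case (x, y) of (x, y) \<Rightarrow> f x * g y)) abs_summable_on A"
    by (simp add: norm_mult infsum_cmult_right' infsum_nonneg abs_mult)
qed

lemma infsum_Times:
  fixes f :: "'a \<Rightarrow> complex" and g :: "'b \<Rightarrow> complex"
  assumes "f abs_summable_on A" "g abs_summable_on B"
  shows "infsum f A * infsum g B = (\<Sum>\<^sub>\<infinity>(x, y)\<in>A \<times> B. f x * g y)"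
  using infsum_Sigma'_banach[of "\<lambda>x y. f x * g y" A "\<lambda>_. B"]
    abs_summable_summable[OF abs_summable_on_Times[OF assms]]
  by (simp add: infsum_cmult_right' infsum_cmult_left')

section \<open>Holomorphy of Laurent series\<close>

text \<open>
  The tail of the differentiated series is at most the tail of $\sum_n M_n$ times
  $\|h\|$, uniformly on the convex set; this is the uniformity that differentiation term by
  term asks for.
\<close>

lemma has_derivative_series_dominated:
  fixes f :: "nat \<Rightarrow> 'a::real_normed_vector \<Rightarrow> 'b::banach"
  assumes "convex S"
    and deriv: "\<And>n x. x \<in> S \<Longrightarrow> (f n has_derivative f' n x) (at x within S)"
    and bound: "\<And>n x h. x \<in> S \<Longrightarrow> norm (f' n x h) \<le> M n * norm h"
    and M: "summable M"
    and x: "x \<in> S" and sm: "\<And>x. x \<in> S \<Longrightarrow> summable (\<lambda>n. f n x)"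
  shows "((\<lambda>x. \<Sum>n. f n x) has_derivative (\<lambda>h. \<Sum>n. f' n x h)) (at x within S)"
proof -
  have sf': "summable (\<lambda>n. f' n x h)" if "x \<in> S" for x h
    by (rule summable_comparison_test'[OF summable_mult2[OF M, of "norm h"]]) (use bound that in auto)
  have "\<exists>g. \<forall>x\<in>S. (\<lambda>n. f n x) sums (g x) \<and> (g has_derivative (\<lambda>h. \<Sum>n. f' n x h)) (at x within S)"
  proof (rule has_derivative_series[OF \<open>convex S\<close> deriv _ x])
    show "(\<lambda>n. f n x) sums (\<Sum>n. f n x)" using sm x by blast
    fix e :: real assume "e > 0"
    from suminf_exist_split[OF this M] obtain N where N: "\<And>n. n \<ge> N \<Longrightarrow> norm (\<Sum>i. M (i + n)) < e"
      by auto
    show "\<forall>\<^sub>F n in sequentially. \<forall>x\<in>S. \<forall>h. norm (sum (\<lambda>i. f' i x h) {..<n} - (\<Sum>n. f' n x h)) \<le> e * norm h"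
      unfolding eventually_sequentially
    proof (intro exI[of _ N] allI impI ballI)
      fix n x and h :: 'a assume n: "N \<le> n" and x: "x \<in> S"
      have sM: "summable (\<lambda>i. M (i + n) * norm h)"
        using M by (intro summable_mult2) (simp add: summable_iff_shift)
      have "norm (sum (\<lambda>i. f' i x h) {..<n} - (\<Sum>n. f' n x h)) = norm (\<Sum>i. f' (i + n) x h)"
        using suminf_minus_initial_segment[OF sf'[OF x], of n h] by (simp add: norm_minus_commute)
      also have "\<dots> \<le> (\<Sum>i. M (i + n) * norm h)"
        using bound[OF x] sM by (intro norm_suminf_le) auto
      also have "\<dots> = (\<Sum>i. M (i + n)) * norm h"
        using M by (intro suminf_mult2[symmetric]) (simp add: summable_iff_shift)
      also have "\<dots> \<le> e * norm h"
        using N[OF n] by (intro mult_right_mono) auto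
      finally show "norm (sum (\<lambda>i. f' i x h) {..<n} - (\<Sum>n. f' n x h)) \<le> e * norm h" .
    qed
  qed
  then obtain g where g: "\<forall>x\<in>S. (\<lambda>n. f n x) sums (g x) \<and> (g has_derivative (\<lambda>h. \<Sum>n. f' n x h)) (at x within S)"
    by blast
  have "g y = (\<Sum>n. f n y)" if "y \<in> S" for y
    using g that by (auto simp: sums_iff)
  thus ?thesis
    using g x by (metis (mono_tags, lifting) has_derivative_transform)
qed

lemma qpow_has_derivative:
  assumes "q > 1"
  shows "((\<lambda>s. qpow q s y) has_derivative
           (\<lambda>h. - (\<Sum>i\<in>UNIV. of_int (y $ i) * h $ i) * of_real (ln q) * qpow q s y)) (at s within S)"
proof -
  have q: "qpow q s y = exp (- (\<Sum>i\<in>UNIV. of_int (y $ i) * s $ i) * of_real (ln q))" for s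
    using assms by (simp add: qpow_def powr_def Ln_of_nat mult.commute)
  have "((\<lambda>s. - (\<Sum>i\<in>UNIV. of_int (y $ i) * s $ i) * of_real (ln q)) has_derivative
        (\<lambda>h. - (\<Sum>i\<in>UNIV. of_int (y $ i) * h $ i) * of_real (ln q))) (at s within S)"
    by (auto intro!: derivative_eq_intros bounded_linear_imp_has_derivative[OF bounded_linear_vec_nth])
  from has_derivative_compose[OF this DERIV_exp[unfolded has_field_derivative_def]] show ?thesis
    by (simp add: q mult_ac)
qed

lemma tube_convex: "convex (tube (Lam_dual_gt \<eta>))"
proof -
  have eq: "tube (Lam_dual_gt \<eta>) = (\<Inter>i. (\<lambda>s. Re (s $ i)) -` {\<eta><..})"
    by (auto simp: tube_gt)
  show ?thesis
    unfolding eq by (auto intro!: convex_INT convex_linear_vimage bounded_linear.linear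
          bounded_linear_compose[OF bounded_linear_Re bounded_linear_vec_nth])
qed

lemma tube_open: "open (tube (Lam_dual_gt \<eta>))"
proof -
  have eq: "tube (Lam_dual_gt \<eta>) = (\<Inter>i. {s. \<eta> < Re (s $ i)})"
    by (auto simp: tube_gt)
  show ?thesis
    unfolding eq by (auto intro!: open_INT open_Collect_less continuous_intros)
qed

lemma infinite_orthant: "infinite (orthant (UNIV :: 'i::finite set))"
proof
  assume "finite (orthant (UNIV :: 'i::finite set))"
  moreover have "range (\<lambda>n::nat. (\<chi> i. int n) :: int ^ 'i) \<subseteq> orthant UNIV"
    by (auto simp: orthant_def)
  ultimately have "finite (range (\<lambda>n::nat. (\<chi> i. int n) :: int ^ 'i))"
    by (rule finite_subset[rotated])
  moreover have "inj (\<lambda>n::nat. (\<chi> i. int n) :: int ^ 'i)"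
    by (auto simp: inj_def vec_eq_iff)
  ultimately show False
    using finite_imageD by blast
qed

text \<open>
  Differentiation costs a factor equal to the size of the exponent. On a smaller tube
  $\Re(s_i) > \delta$ this factor is paid for by comparing with the absolutely convergent series
  at $\Re(s_i) = \delta/2$, since $u \leq e^u$.
\<close>

lemma holomorphic_Lser:
  fixes b :: "int ^ 'i \<Rightarrow> complex"
  assumes q: "q > 1"
    and conv: "\<And>s. s \<in> tube (Lam_dual_gt 0) \<Longrightarrow> Lser_converges UNIV Lam b (qpow q s)"
  shows "holomorphic_several (\<lambda>s. Lser UNIV Lam b (qpow q s)) (tube (Lam_dual_gt 0))"
  unfolding holomorphic_several_def
proof
  fix s0 :: "complex ^ 'i" assume s0: "s0 \<in> tube (Lam_dual_gt 0)"
  define \<delta> where "\<delta> = Min (range (\<lambda>i. Re (s0 $ i))) / 2"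
  have \<delta>: "\<delta> > 0" using s0 by (simp add: \<delta>_def tube_gt)
  define S :: "(complex ^ 'i) set" where "S = tube (Lam_dual_gt \<delta>)"
  have "\<delta> < Re (s0 $ i)" for i
  proof -
    have "Min (range (\<lambda>i. Re (s0 $ i))) \<le> Re (s0 $ i)" by (intro Min_le) auto
    thus ?thesis using \<delta> unfolding \<delta>_def by linarith
  qed
  hence s0S: "s0 \<in> S" by (simp add: S_def tube_gt)
  have S0: "S \<subseteq> tube (Lam_dual_gt 0)" using \<delta> tube_gt_mono[of 0 \<delta>] by (simp add: S_def)
  define t :: "complex ^ 'i" where "t = (\<chi> i. of_real (\<delta> / 2))"
  have t: "t \<in> tube (Lam_dual_gt 0)" using \<delta> by (simp add: t_def tube_gt)
  define e where "e = from_nat_into (orthant (UNIV :: 'i set))"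
  have bij: "bij_betw e UNIV (orthant UNIV)"
    unfolding e_def using infinite_orthant by (intro bij_betw_from_nat_into) auto
  hence eo: "e n \<in> orthant UNIV" for n by (auto simp: bij_betw_def)
  define f where "f n s = b (e n) * qpow q s (e n)" for n s
  define f' where "f' n s h = - (\<Sum>i\<in>UNIV. of_int (e n $ i) * h $ i) * of_real (ln q) * f n s" for n s h
  define K where "K n = 2 / \<delta> * norm (f n t)" for n
  have sums: "(\<lambda>n. norm (f n s)) sums (\<Sum>\<^sub>\<infinity>y\<in>orthant UNIV. norm (b y * qpow q s y))"
    and sums': "(\<lambda>n. f n s) sums Lser UNIV Lam b (qpow q s)"
    if "s \<in> tube (Lam_dual_gt 0)" for s
  proof -
    have a: "(\<lambda>y. b y * qpow q s y) abs_summable_on orthant UNIV"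
      using conv[OF that] by (simp add: Lser_converges_Lam)
    hence "((\<lambda>y. norm (b y * qpow q s y)) has_sum (\<Sum>\<^sub>\<infinity>y\<in>orthant UNIV. norm (b y * qpow q s y))) (orthant UNIV)"
      by simp
    thus "(\<lambda>n. norm (f n s)) sums (\<Sum>\<^sub>\<infinity>y\<in>orthant UNIV. norm (b y * qpow q s y))"
      by (subst (asm) has_sum_reindex_bij_betw[OF bij, symmetric]) (simp add: f_def has_sum_imp_sums)
    have "((\<lambda>y. b y * qpow q s y) has_sum (Lser UNIV Lam b (qpow q s))) (orthant UNIV)"
      using abs_summable_summable[OF a] by (simp add: Lser_Lam)
    thus "(\<lambda>n. f n s) sums Lser UNIV Lam b (qpow q s)"
      by (subst (asm) has_sum_reindex_bij_betw[OF bij, symmetric]) (simp add: f_def has_sum_imp_sums)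
  qed
  have K: "summable K"
    unfolding K_def using sums[OF t] by (intro summable_mult) (auto simp: sums_iff)
  have bound: "norm (f' n s h) \<le> K n * norm h" if "s \<in> S" for n s h
  proof -
    define x where "x = real_of_int (height (e n))"
    have x0: "0 \<le> x" unfolding x_def using height_nonneg[OF eo[of n]] by simp
    have "norm (\<Sum>i\<in>UNIV. of_int (e n $ i) * h $ i) \<le> (\<Sum>i\<in>UNIV. of_int (e n $ i) * norm h)"
      using eo[of n] Finite_Cartesian_Product.norm_nth_le[of h]
      by (intro sum_norm_le) (auto simp: norm_mult orthant_def intro!: mult_left_mono)
    hence 1: "norm (\<Sum>i\<in>UNIV. of_int (e n $ i) * h $ i) \<le> x * norm h"
      by (simp add: x_def height_def sum_distrib_right)
    have qx: "norm (qpow q s (e n)) \<le> norm (qpow q (\<chi> i. of_real \<delta>) (e n))"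
      using eo[of n] that q by (intro norm_qpow_mono) (auto simp: S_def tube_gt less_imp_le)
    define A where "A = \<delta> / 2 * x * ln q"
    have "A \<le> exp A" using exp_ge_add_one_self[of A] by linarith
    hence "A * exp (- A) \<le> 1" by (simp add: exp_minus field_simps)
    hence "2 / \<delta> * exp (- A) * (A * exp (- A)) \<le> 2 / \<delta> * exp (- A) * 1"
      using \<delta> by (intro mult_left_mono) auto
    moreover have "x * ln q = 2 / \<delta> * A" using \<delta> by (simp add: A_def)
    ultimately have "x * ln q * exp (- A) * exp (- A) \<le> 2 / \<delta> * exp (- A)"
      by (simp add: mult_ac)
    moreover have nq: "norm (qpow q (\<chi> i. of_real c) (e n)) = exp (- (c * x * ln q))" for c
      using q by (simp add: norm_qpow_const powr_def x_def)
    moreover have "exp (- (\<delta> * x * ln q)) = exp (- A) * exp (- A)"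
      by (simp add: A_def flip: exp_add)
    moreover have "norm (qpow q t (e n)) = exp (- A)"
      unfolding t_def A_def by (rule nq)
    ultimately have "x * ln q * norm (qpow q (\<chi> i. of_real \<delta>) (e n)) \<le> 2 / \<delta> * norm (qpow q t (e n))"
      by (simp add: mult.assoc)
    moreover have "x * ln q * norm (qpow q s (e n)) \<le> x * ln q * norm (qpow q (\<chi> i. of_real \<delta>) (e n))"
      using qx x0 q by (intro mult_left_mono) auto
    ultimately have 2: "x * ln q * norm (qpow q s (e n)) \<le> 2 / \<delta> * norm (qpow q t (e n))"
      by linarith
    have "norm (f' n s h) = norm (\<Sum>i\<in>UNIV. of_int (e n $ i) * h $ i) * (ln q * norm (b (e n)) * norm (qpow q s (e n)))"
      using q by (simp add: f'_def f_def norm_mult)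
    also have "\<dots> \<le> x * norm h * (ln q * norm (b (e n)) * norm (qpow q s (e n)))"
      using 1 q by (intro mult_right_mono) auto
    also have "\<dots> = norm (b (e n)) * norm h * (x * ln q * norm (qpow q s (e n)))"
      by simp
    also have "\<dots> \<le> norm (b (e n)) * norm h * (2 / \<delta> * norm (qpow q t (e n)))"
      using 2 by (intro mult_left_mono) auto
    also have "\<dots> = K n * norm h"
      by (simp add: K_def f_def norm_mult)
    finally show ?thesis .
  qed
  have "((\<lambda>s. \<Sum>n. f n s) has_derivative (\<lambda>h. \<Sum>n. f' n s0 h)) (at s0 within S)"
  proof (rule has_derivative_series_dominated[OF _ _ bound K s0S])
    show "convex S" by (simp add: S_def tube_convex)
    show "summable (\<lambda>n. f n s)" if "s \<in> S" for s
      using sums' S0 that by (auto simp: sums_iff)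
    show "(f n has_derivative f' n s) (at s within S)" for n s
      unfolding f_def[abs_def] f'_def
      by (rule has_derivative_eq_rhs[OF has_derivative_mult_right[OF qpow_has_derivative[OF q]]]) (simp add: fun_eq_iff)
  qed
  hence "((\<lambda>s. \<Sum>n. f n s) has_derivative (\<lambda>h. \<Sum>n. f' n s0 h)) (at s0)"
    using s0S by (simp add: S_def at_within_open[OF _ tube_open])
  hence 1: "((\<lambda>s. Lser UNIV Lam b (qpow q s)) has_derivative (\<lambda>h. \<Sum>n. f' n s0 h)) (at s0)"
    by (rule has_derivative_transform_within_open[OF _ tube_open s0]) (use sums' in \<open>auto simp: sums_iff\<close>)
  moreover have "(\<Sum>n. f' n s0 (c *s h)) = c * (\<Sum>n. f' n s0 h)" for c h
  proof -
    have "summable (\<lambda>n. f' n s0 h)"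
      by (rule summable_comparison_test'[OF summable_mult2[OF K, of "norm h"]]) (use bound s0S in auto)
    moreover have "f' n s0 (c *s h) = c * f' n s0 h" for n
      by (simp add: f'_def sum_distrib_left mult_ac)
    ultimately show ?thesis by (simp add: suminf_mult)
  qed
  ultimately show "\<exists>D. ((\<lambda>s. Lser UNIV Lam b (qpow q s)) has_derivative D) (at s0) \<and> (\<forall>c v. D (c *s v) = c * D v)"
    by blast
qed

lemma holomorphic_several_mult:
  assumes "holomorphic_several f S" "holomorphic_several g S"
  shows "holomorphic_several (\<lambda>s. f s * g s) S"
  unfolding holomorphic_several_def
proof
  fix s assume "s \<in> S"
  with assms obtain D E where "(f has_derivative D) (at s)" "\<forall>c v. D (c *s v) = c * D v"
    "(g has_derivative E) (at s)" "\<forall>c v. E (c *s v) = c * E v"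
    unfolding holomorphic_several_def by blast
  thus "\<exists>D. ((\<lambda>s. f s * g s) has_derivative D) (at s) \<and> (\<forall>c v. D (c *s v) = c * D v)"
    by (intro exI[of _ "\<lambda>h. f s * E h + D h * g s"]) (auto intro!: has_derivative_eq_rhs[OF has_derivative_mult] simp: algebra_simps)
qed

lemma holomorphic_several_cong:
  assumes "holomorphic_several f (tube (Lam_dual_gt \<eta>))"
    "\<And>s. s \<in> tube (Lam_dual_gt \<eta>) \<Longrightarrow> f s = g s"
  shows "holomorphic_several g (tube (Lam_dual_gt \<eta>))"
  using assms has_derivative_transform_within_open[OF _ tube_open]
  unfolding holomorphic_several_def by metis

section \<open>Subgroups of the lattice and a linear bound\<close>

lemma group_Ngrp: "group Ngrp"
  by (rule groupI) (auto simp: Ngrp_def add.assoc intro: exI[of _ "- x" for x])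

lemma comm_group_Ngrp: "comm_group Ngrp"
  by (rule group.group_comm_groupI[OF group_Ngrp]) (auto simp: Ngrp_def add.commute)

lemma Ngrp_simps [simp]: "carrier Ngrp = UNIV" "mult Ngrp = (+)" "one Ngrp = 0"
  by (auto simp: Ngrp_def)

lemma inv_Ngrp [simp]: "inv\<^bsub>Ngrp\<^esub> x = - x"
  using group.inv_equality[OF group_Ngrp, of "- x" x] by simp

lemma subgroup_Ngrp_iff:
  "subgroup M Ngrp \<longleftrightarrow> 0 \<in> M \<and> (\<forall>x\<in>M. \<forall>y\<in>M. x + y \<in> M) \<and> (\<forall>x\<in>M. - x \<in> M)"
  by (auto simp: subgroup_def)

lemma subgroup_NgrpD:
  assumes "subgroup M Ngrp"
  shows "0 \<in> M" "x \<in> M \<Longrightarrow> y \<in> M \<Longrightarrow> x + y \<in> M" "x \<in> M \<Longrightarrow> - x \<in> M" "x \<in> M \<Longrightarrow> y \<in> M \<Longrightarrow> x - y \<in> M"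
  using assms by (auto simp: subgroup_Ngrp_iff simp flip: add_uminus_conv_diff)

text \<open>
  The lemmas from here to \<open>finite_minimal\<close> are Dickson's lemma: an antichain in
  $\mathbf N^r$ is finite, because every sequence has a subsequence that increases in all
  coordinates.
\<close>

lemma mono_subsequence_nat: "\<exists>r::nat \<Rightarrow> nat. strict_mono r \<and> mono (\<lambda>n. g (r n) :: nat)"
proof -
  obtain h where h: "strict_mono h" "monoseq (\<lambda>n. g (h n))"
    using seq_monosub[of g] by auto
  from h(2) consider "incseq (\<lambda>n. g (h n))" | "decseq (\<lambda>n. g (h n))"
    by (auto simp: monoseq_iff)
  thus ?thesis
  proof cases
    case 1 thus ?thesis using h by blast
  next
    case 2
    obtain m where m: "\<And>n. g (h m) \<le> g (h n)"
      using ex_has_least_nat[of "\<lambda>_. True" _ "\<lambda>n. g (h n)"] by auto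
    have "g (h (m + n)) = g (h m)" for n
      using m[of "m + n"] 2 by (simp add: decseq_def order_antisym)
    moreover have "strict_mono (\<lambda>n. h (m + n))" using h(1) by (simp add: strict_mono_def)
    ultimately show ?thesis by (intro exI[of _ "\<lambda>n. h (m + n)"]) (simp add: mono_def)
  qed
qed

lemma mono_subsequence_coordinates:
  fixes f :: "nat \<Rightarrow> 'a \<Rightarrow> nat"
  assumes "finite A"
  shows "\<exists>r::nat \<Rightarrow> nat. strict_mono r \<and> (\<forall>c\<in>A. mono (\<lambda>n. f (r n) c))"
  using assms
proof induction
  case empty
  show ?case by (intro exI[of _ id]) (auto simp: strict_mono_def)
next
  case (insert c A)
  then obtain r :: "nat \<Rightarrow> nat" where r: "strict_mono r" "\<forall>c\<in>A. mono (\<lambda>n. f (r n) c)" by blast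
  obtain h :: "nat \<Rightarrow> nat" where h: "strict_mono h" "mono (\<lambda>n. f (r (h n)) c)"
    using mono_subsequence_nat[of "\<lambda>n. f (r n) c"] by blast
  have "mono (\<lambda>n. f (r (h n)) c')" if "c' \<in> A" for c'
    using r(2) that h(1) by (auto simp: mono_def strict_mono_less_eq)
  moreover have "strict_mono (\<lambda>n. r (h n))"
    using r(1) h(1) by (simp add: strict_mono_def)
  ultimately show ?case using h(2) by (intro exI[of _ "\<lambda>n. r (h n)"]) auto
qed

lemma finite_minimal:
  fixes S :: "('a::finite \<Rightarrow> nat) set"
  shows "finite {u \<in> S. \<forall>v\<in>S. v \<le> u \<longrightarrow> v = u}" (is "finite ?Min")
proof (rule ccontr)
  assume "infinite ?Min"
  then obtain f :: "nat \<Rightarrow> 'a \<Rightarrow> nat" where f: "inj f" "range f \<subseteq> ?Min"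
    using infinite_countable_subset by blast
  obtain r :: "nat \<Rightarrow> nat" where r: "strict_mono r" "\<forall>c\<in>UNIV. mono (\<lambda>n. f (r n) c)"
    using mono_subsequence_coordinates[of UNIV f] by auto
  have "f (r 0) \<le> f (r 1)" using r(2) by (auto simp: le_fun_def mono_def)
  hence "f (r 0) = f (r 1)" using f(2) by blast
  hence "r 0 = r 1" using f(1) by (simp add: inj_eq)
  thus False using strict_monoD[OF r(1), of 0 1] by simp
qed

text \<open>
  The minimal nonzero elements of the monoid are finitely many, and by closure under subtraction
  every element is a sum of them. Each of them has a positive \<open>B\<close>-part, so one constant that
  works for all minimal elements works for their sums.
\<close>

lemma linear_bound_on_monoid:
  fixes S :: "('a::finite \<Rightarrow> nat) set"
  assumes diff: "\<And>u v. u \<in> S \<Longrightarrow> v \<in> S \<Longrightarrow> v \<le> u \<Longrightarrow> u - v \<in> S"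
    and AB: "A \<union> B = UNIV"
    and zero: "\<And>u. u \<in> S \<Longrightarrow> sum u B = 0 \<Longrightarrow> u = (\<lambda>_. 0)"
  shows "\<exists>C. \<forall>u\<in>S. sum u A \<le> C * sum u B"
proof -
  define T where "T = {u \<in> S - {\<lambda>_. 0}. \<forall>v\<in>S - {\<lambda>_. 0}. v \<le> u \<longrightarrow> v = u}"
  define C where "C = (\<Sum>v\<in>T. sum v A)"
  have finT: "finite T" unfolding T_def by (rule finite_minimal)
  have C: "sum v A \<le> C" if "v \<in> T" for v
    unfolding C_def using finT that by (intro member_le_sum) auto
  have below: "\<exists>v\<in>T. v \<le> u" if "u \<in> S" "u \<noteq> (\<lambda>_. 0)" for u
    using that
  proof (induction "sum u UNIV" arbitrary: u rule: less_induct)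
    case less
    show ?case
    proof (cases "u \<in> T")
      case False
      then obtain v where v: "v \<in> S" "v \<noteq> (\<lambda>_. 0)" "v \<le> u" "v \<noteq> u" using less.prems by (auto simp: T_def)
      then obtain c where "v c < u c" by (metis le_fun_def ext order_le_imp_less_or_eq)
      hence "sum v UNIV < sum u UNIV" using v(3) by (intro sum_strict_mono_ex1) (auto simp: le_fun_def)
      with less.hyps v obtain w where "w \<in> T" "w \<le> v" by blast
      thus ?thesis using v(3) by (meson order_trans)
    qed auto
  qed
  have "sum u A \<le> C * sum u B" if "u \<in> S" for u
    using that
  proof (induction "sum u UNIV" arbitrary: u rule: less_induct)
    case less
    show ?case
    proof (cases "u = (\<lambda>_. 0)")
      case False
      then obtain v where v: "v \<in> T" "v \<le> u" using below less.prems by blast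
      hence vS: "v \<in> S" "v \<noteq> (\<lambda>_. 0)" by (auto simp: T_def)
      then obtain c where "v c \<noteq> 0" by auto
      have uv: "u = (\<lambda>c. (u - v) c + v c)" using v(2) by (auto simp: le_fun_def fun_eq_iff)
      have add: "sum u X = sum (u - v) X + sum v X" for X
        by (subst uv) (simp add: sum.distrib)
      have "sum v UNIV > 0" using \<open>v c \<noteq> 0\<close> by (auto intro!: sum_pos2[of _ c])
      hence "sum (u - v) A \<le> C * sum (u - v) B"
        using less.hyps[of "u - v"] diff[OF less.prems vS(1) v(2)] add[of UNIV] by simp
      moreover have "sum v B \<ge> 1" using zero[OF vS(1)] vS(2) by (metis less_one not_le)
      hence "C * 1 \<le> C * sum v B" by (intro mult_left_mono) auto
      hence "sum v A \<le> C * sum v B" using C[OF v(1)] by linarith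
      ultimately show ?thesis by (simp add: add distrib_left)
    qed simp
  qed
  thus ?thesis by blast
qed

text \<open>
  Apply \<open>linear_bound_on_monoid\<close> to the monoid of pairs $(k, w)$ with $dk + w \in M$: pairs
  with $w = 0$ have $k = 0$ by assumption. Working with integral points only, this avoids
  any discussion of the rationality of $M_{\mathbf R}$ intersected with a face.
\<close>

lemma height_bound:
  fixes M :: "(int ^ 'i) set" and d :: int
  assumes M: "subgroup M Ngrp"
    and trivial: "\<And>k. k \<in> orthant K \<Longrightarrow> d *s k \<in> M \<Longrightarrow> k = 0"
  shows "\<exists>C\<ge>0. \<forall>k\<in>orthant K. \<forall>w\<in>orthant UNIV. d *s k + w \<in> M \<longrightarrow> height k \<le> C * height w"
proof -
  define l :: "('i + 'i \<Rightarrow> nat) \<Rightarrow> int ^ 'i" where "l u = (\<chi> i. int (u (Inl i)))" for u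
  define r :: "('i + 'i \<Rightarrow> nat) \<Rightarrow> int ^ 'i" where "r u = (\<chi> i. int (u (Inr i)))" for u
  define S where "S = {u. l u \<in> orthant K \<and> d *s l u + r u \<in> M}"
  have "\<exists>C. \<forall>u\<in>S. sum u (range Inl) \<le> C * sum u (range Inr)"
  proof (rule linear_bound_on_monoid)
    show "range Inl \<union> range Inr = (UNIV :: ('i + 'i) set)"
      by (metis UNIV_sum)
    fix u v assume uv: "u \<in> S" "v \<in> S" "v \<le> u"
    have lr: "l (u - v) = l u - l v" "r (u - v) = r u - r v"
      using uv(3) by (simp_all add: l_def r_def vec_eq_iff le_fun_def of_nat_diff)
    have "l (u - v) \<in> orthant K"
      using uv by (auto simp: S_def l_def orthant_def)
    moreover have "d *s l (u - v) + r (u - v) = (d *s l u + r u) - (d *s l v + r v)"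
      by (simp add: lr vec_eq_iff algebra_simps)
    hence "d *s l (u - v) + r (u - v) \<in> M"
      using uv subgroup_NgrpD(4)[OF M] by (simp add: S_def)
    ultimately show "u - v \<in> S"
      by (simp add: S_def)
  next
    fix u assume u: "u \<in> S" "sum u (range Inr) = 0"
    have inr: "u (Inr i) = 0" for i using u(2) by simp
    hence "r u = 0" by (simp add: r_def vec_eq_iff)
    hence "l u = 0" using u(1) trivial by (simp add: S_def)
    hence "u (Inl i) = 0" for i by (auto simp: l_def vec_eq_iff)
    with inr show "u = (\<lambda>_. 0)" by (intro ext) (metis sum.exhaust)
  qed
  then obtain C where C: "\<And>u. u \<in> S \<Longrightarrow> sum u (range Inl) \<le> C * sum u (range Inr)" by blast
  have "height k \<le> int C * height w" if k: "k \<in> orthant K" and w: "w \<in> orthant UNIV" and kw: "d *s k + w \<in> M" for k w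
  proof -
    define u where "u = case_sum (\<lambda>i. nat (k $ i)) (\<lambda>i. nat (w $ i))"
    have lr: "l u = k" "r u = w"
      using k w by (auto simp: l_def r_def u_def vec_eq_iff orthant_def)
    hence "u \<in> S" using k kw by (simp add: S_def)
    hence "int (sum u (range Inl)) \<le> int C * int (sum u (range Inr))"
      using C by (metis of_nat_le_iff of_nat_mult)
    moreover have "int (sum u (range Inl)) = height k" "int (sum u (range Inr)) = height w"
      using k w by (auto simp: sum.reindex u_def height_def orthant_def intro!: sum.cong)
    ultimately show ?thesis by simp
  qed
  thus ?thesis by (intro exI[of _ "int C"]) auto
qed

section \<open>Sums of cone products\<close>

text \<open>
  For linearly independent $F$ this is the Laurent series of a simplicial cone, see
  \<open>cone_prod_series\<close>; the product form is the one the induction over boxes produces.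
\<close>

definition cone_prod :: "nat \<Rightarrow> (int ^ 'i) set \<Rightarrow> complex ^ 'i \<Rightarrow> complex" where
  "cone_prod q F s = (\<Prod>p\<in>F. qpow q s p / (1 - qpow q s p))"

text \<open>
  Finite sums of terms $g \cdot \prod_{p \in F} Q_p/(1 - Q_p)$, up to equality on the tube. All
  generators are kept in a given set \<open>A\<close>, which records the face and the lattice they come from.
\<close>

inductive cone_sum :: "nat \<Rightarrow> (int ^ 'i) set \<Rightarrow> (complex ^ 'i \<Rightarrow> complex) \<Rightarrow> bool" for q A where
  zero: "(\<And>s. s \<in> tube (Lam_dual_gt 0) \<Longrightarrow> H s = 0) \<Longrightarrow> cone_sum q A H"
| add: "elementary_admissible_0 q g \<Longrightarrow> finite F \<Longrightarrow> F \<subseteq> A \<Longrightarrow> independent (in_NR ` F) \<Longrightarrow> cone_sum q A H' \<Longrightarrow>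
        (\<And>s. s \<in> tube (Lam_dual_gt 0) \<Longrightarrow> H s = g s * cone_prod q F s + H' s) \<Longrightarrow> cone_sum q A H"

lemma cone_sum_cong:
  assumes "cone_sum q A H" "\<And>s. s \<in> tube (Lam_dual_gt 0) \<Longrightarrow> H' s = H s"
  shows "cone_sum q A H'"
  using assms(1)
proof cases
  case zero
  show ?thesis by (rule cone_sum.zero) (simp add: zero assms(2))
next
  case (add g F H'')
  show ?thesis by (rule cone_sum.add[OF add(1-5)]) (simp add: add(6) assms(2))
qed

lemma cone_sum_plus:
  assumes "cone_sum q A H" "cone_sum q A H'"
  shows "cone_sum q A (\<lambda>s. H s + H' s)"
  using assms(1)
proof induction
  case (zero H)
  show ?case by (rule cone_sum_cong[OF assms(2)]) (simp add: zero)
next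
  case (add g F H'' H)
  show ?case by (rule cone_sum.add[OF add.hyps(1-4) add.IH]) (simp add: add.hyps)
qed

lemma cone_sum_sum:
  assumes "\<And>i. i \<in> I \<Longrightarrow> cone_sum q A (H i)"
  shows "cone_sum q A (\<lambda>s. \<Sum>i\<in>I. H i s)"
  using assms
  by (induction I rule: infinite_finite_induct) (auto intro: cone_sum.zero cone_sum_plus)

text \<open>
  Dividing by $1 - Q_p$ replaces $g \prod_F$ by $g \prod_F + g \prod_{F \cup \{p\}}$. All
  generators so far vanish at the coordinate \<open>c\<close> and \<open>p\<close> does not, so \<open>p\<close> lies outside
  their span.
\<close>

lemma cone_sum_divide:
  assumes "cone_sum q A H" and q: "q > 1"
    and A: "A \<subseteq> B" "\<And>x. x \<in> A \<Longrightarrow> x $ c = 0"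
    and p: "p \<in> B" "p $ c \<noteq> 0" "p \<in> orthant UNIV"
  shows "cone_sum q B (\<lambda>s. H s / (1 - qpow q s p))"
  using assms(1)
proof (induction rule: cone_sum.induct)
  case (zero H)
  thus ?case by (intro cone_sum.zero) auto
next
  case (add g F H' H)
  have "in_NR p \<notin> span (in_NR ` F)"
  proof
    assume "in_NR p \<in> span (in_NR ` F)"
    moreover have "subspace {x :: real ^ 'a. x $ c = 0}" by (auto simp: subspace_def)
    hence "span (in_NR ` F) \<subseteq> {x. x $ c = 0}"
      using add.hyps(3) A(2) by (intro span_minimal) auto
    ultimately show False using p(2) by auto
  qed
  hence ind: "independent (in_NR ` insert p F)"
    using add.hyps(4) by (simp add: independent_insertI)
  have pF: "p \<notin> F" using add.hyps(3) A(2) p(2) by auto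
  show ?case
  proof (rule cone_sum.add[of q g F B "\<lambda>s. g s * cone_prod q (insert p F) s + H' s / (1 - qpow q s p)"])
    show "cone_sum q B (\<lambda>s. g s * cone_prod q (insert p F) s + H' s / (1 - qpow q s p))"
      by (rule cone_sum.add[OF add.hyps(1) _ _ ind add.IH]) (use add.hyps(2,3) A(1) p(1) in auto)
    fix s :: "complex ^ 'a" assume s: "s \<in> tube (Lam_dual_gt 0)"
    have "norm (qpow q s p) < 1" using q p s by (intro norm_qpow_lt_1) auto
    hence Q: "qpow q s p \<noteq> 1" by auto
    have ins: "cone_prod q (insert p F) s = qpow q s p / (1 - qpow q s p) * cone_prod q F s"
      using add.hyps(2) pF by (simp add: cone_prod_def)
    have split: "w * P / (1 - Q) = w * P + w * (Q / (1 - Q) * P)" if "Q \<noteq> 1" for w P Q :: complex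
      using that by (simp add: divide_simps) (simp add: algebra_simps)
    show "H s / (1 - qpow q s p) =
        g s * cone_prod q F s + (g s * cone_prod q (insert p F) s + H' s / (1 - qpow q s p))"
      by (simp only: add.hyps(6)[OF s] add_divide_distrib split[OF Q] ins add.assoc)
  qed (use add.hyps A in auto)
qed

section \<open>Series of pairs over boxes\<close>

definition pairs :: "(int ^ 'i) set \<Rightarrow> (int ^ 'i) set \<Rightarrow> ((int ^ 'i) \<times> (int ^ 'i)) set" where
  "pairs M X = {(y, x). y \<in> orthant UNIV \<and> x \<in> X \<and> y + x \<in> M}"

definition dbox :: "int \<Rightarrow> int ^ 'i \<Rightarrow> 'i set \<Rightarrow> (int ^ 'i) set" where
  "dbox d v K = (\<lambda>k. v + d *s k) ` orthant K"

lemma dbox_subset: "0 \<le> d \<Longrightarrow> v \<in> orthant UNIV \<Longrightarrow> dbox d v K \<subseteq> orthant UNIV"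
  by (auto simp: dbox_def orthant_def)

text \<open>
  Points of a box either sit at the lower end of coordinate \<open>c\<close>, which gives a box with one free
  coordinate less, or survive a shift of the box by one step.
\<close>

lemma dbox_split:
  assumes "d > 0" "c \<in> K"
  shows "dbox d v K = dbox d v (K - {c}) \<union> dbox d (v + d *s axis c 1) K"
    and "dbox d v (K - {c}) \<inter> dbox d (v + d *s axis c 1) K = {}"
proof -
  have "v + d *s k \<in> dbox d v (K - {c}) \<union> dbox d (v + d *s axis c 1) K" if k: "k \<in> orthant K" for k
  proof (cases "k $ c = 0")
    case True
    hence "k \<in> orthant (K - {c})" using k by (auto simp: orthant_def)
    thus ?thesis by (auto simp: dbox_def)
  next
    case False
    hence "k - axis c 1 \<in> orthant K"
      using orthantD[OF k] assms(2) by (auto simp: orthant_def axis_def)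
        (metis antisym_conv2 int_one_le_iff_zero_less)
    moreover have "v + d *s k = (v + d *s axis c 1) + d *s (k - axis c 1)"
      by (simp add: vec_eq_iff algebra_simps)
    ultimately show ?thesis unfolding dbox_def by blast
  qed
  moreover have "dbox d v (K - {c}) \<subseteq> dbox d v K"
    unfolding dbox_def using orthant_mono[of "K - {c}" K] by blast
  moreover have "(v + d *s axis c 1) + d *s k \<in> dbox d v K" if k: "k \<in> orthant K" for k
  proof -
    have "axis c 1 + k \<in> orthant K"
      using k assms(2) by (auto simp: orthant_def axis_def)
    moreover have "(v + d *s axis c 1) + d *s k = v + d *s (axis c 1 + k)"
      by (simp add: vec_eq_iff algebra_simps)
    ultimately show ?thesis unfolding dbox_def by blast
  qed
  ultimately show "dbox d v K = dbox d v (K - {c}) \<union> dbox d (v + d *s axis c 1) K"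
    by (auto simp: dbox_def)
  have "x $ c = v $ c" if "x \<in> dbox d v (K - {c})" for x
    using that by (auto simp: dbox_def orthant_def)
  moreover have "x $ c > v $ c" if "x \<in> dbox d (v + d *s axis c 1) K" for x
  proof -
    from that obtain k where k: "k \<in> orthant K" "x = (v + d *s axis c 1) + d *s k" by (auto simp: dbox_def)
    have "0 \<le> d * k $ c" using orthantD(1)[OF k(1)] assms(1) by (intro mult_nonneg_nonneg) auto
    thus ?thesis using assms(1) by (simp add: k)
  qed
  ultimately show "dbox d v (K - {c}) \<inter> dbox d (v + d *s axis c 1) K = {}"
    by fastforce
qed

locale weighted_lattice =
  fixes q :: nat and M :: "(int ^ 'i) set" and a :: "int ^ 'i \<Rightarrow> complex" and \<epsilon> :: real
  assumes q: "q > 1" and M: "subgroup M Ngrp" and eps: "\<epsilon> > 0"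
    and a: "\<And>s. s \<in> tube (Lam_dual_gt (- \<epsilon>)) \<Longrightarrow> Lser_converges UNIV Lam a (qpow q s)"
begin

text \<open>
  What remains of the product of the two Laurent series after integration over the characters
  of the quotient by \<open>M\<close>, when the second series runs over \<open>X\<close>.
\<close>

definition G :: "(int ^ 'i) set \<Rightarrow> complex ^ 'i \<Rightarrow> complex" where
  "G X s = (\<Sum>\<^sub>\<infinity>(y, x)\<in>pairs M X. a y * qpow q s (y + x))"

lemma a_summable:
  "s \<in> tube (Lam_dual_gt (- \<epsilon>)) \<Longrightarrow> (\<lambda>y. a y * qpow q s y) abs_summable_on orthant UNIV"
  using a by (simp add: Lser_converges_Lam)

lemma a_summable_0:
  "s \<in> tube (Lam_dual_gt 0) \<Longrightarrow> (\<lambda>y. a y * qpow q s y) abs_summable_on orthant UNIV"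
  using eps tube_gt_mono[of "- \<epsilon>" 0] by (intro a_summable) auto

lemma pairs_summable:
  assumes "X \<subseteq> orthant UNIV" "s \<in> tube (Lam_dual_gt 0)"
  shows "(\<lambda>(y, x). a y * qpow q s (y + x)) abs_summable_on pairs M X"
proof -
  have "(\<lambda>(y, x). a y * qpow q s y * qpow q s x) abs_summable_on orthant UNIV \<times> orthant UNIV"
    by (intro abs_summable_on_Times a_summable_0 summable_qpow assms q)
  hence "(\<lambda>(y, x). a y * qpow q s y * qpow q s x) abs_summable_on pairs M X"
    by (rule summable_on_subset_banach) (use assms in \<open>auto simp: pairs_def\<close>)
  thus ?thesis using q by (simp add: qpow_add mult.assoc)
qed

lemma G_Un:
  assumes "X \<subseteq> orthant UNIV" "Y \<subseteq> orthant UNIV" "X \<inter> Y = {}" "s \<in> tube (Lam_dual_gt 0)"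
  shows "G (X \<union> Y) s = G X s + G Y s"
proof -
  have "pairs M (X \<union> Y) = pairs M X \<union> pairs M Y" by (auto simp: pairs_def)
  moreover have "pairs M X \<inter> pairs M Y = {}" using assms(3) by (auto simp: pairs_def)
  ultimately show ?thesis
    unfolding G_def using assms by (simp add: infsum_Un_disjoint abs_summable_summable pairs_summable)
qed

text \<open>
  Translation by an element of \<open>M\<close> does not affect the condition $y + x \in M$.
\<close>

lemma G_shift:
  assumes "p \<in> M"
  shows "G ((\<lambda>x. x + p) ` X) s = qpow q s p * G X s"
proof -
  have "bij_betw (\<lambda>(y, x). (y, x + p)) (pairs M X) (pairs M ((\<lambda>x. x + p) ` X))"
  proof (rule bij_betw_byWitness[where f'="\<lambda>(y, x). (y, x - p)"])
    show "(\<lambda>(y, x). (y, x + p)) ` pairs M X \<subseteq> pairs M ((\<lambda>x. x + p) ` X)"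
    proof clarify
      fix y x assume "(y, x) \<in> pairs M X"
      thus "(y, x + p) \<in> pairs M ((\<lambda>x. x + p) ` X)"
        using subgroup_NgrpD(2)[OF M _ assms, of "y + x"] by (simp add: pairs_def add.assoc)
    qed
    show "(\<lambda>(y, x). (y, x - p)) ` pairs M ((\<lambda>x. x + p) ` X) \<subseteq> pairs M X"
    proof clarify
      fix y x assume "(y, x) \<in> pairs M ((\<lambda>x. x + p) ` X)"
      thus "(y, x - p) \<in> pairs M X"
        using subgroup_NgrpD(4)[OF M _ assms, of "y + x"] by (auto simp: pairs_def algebra_simps)
    qed
  qed auto
  from infsum_reindex_bij_betw[OF this, of "\<lambda>(y, x). a y * qpow q s (y + x)"]
  have "G ((\<lambda>x. x + p) ` X) s = (\<Sum>\<^sub>\<infinity>(y, x)\<in>pairs M X. qpow q s p * (a y * qpow q s (y + x)))"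
    unfolding G_def using q by (simp add: case_prod_unfold qpow_add mult_ac)
  thus ?thesis by (simp add: G_def case_prod_unfold infsum_cmult_right')
qed

text \<open>
  For pairs with $y + x \in M$ the height of $x$ is at most $B_0 + B_1$ times that of $y$. At
  $\Re(s_i) > -\eta$ a pair then costs at most $q^{\eta(|y| + |x|)} = q^{\eta|y| + 2\eta|x|} q^{-\eta|x|}$,
  where the first factor is bounded by a multiple of $q^{\eta(1 + 2B_1)|y|}$. The reserved factor
  $q^{-\eta|x|}$ makes the sum over $x$ converge, and for small $\eta$ the rest is covered by the
  convergence of the series of $a$ to the left of the tube.
\<close>

lemma G_transversal:
  assumes d: "d > 0" and v: "v \<in> orthant UNIV"
    and trivial: "\<And>k. k \<in> orthant K \<Longrightarrow> d *s k \<in> M \<Longrightarrow> k = 0"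
  shows "elementary_admissible_0 q (G (dbox d v K))"
proof -
  obtain C where C: "C \<ge> 0"
    "\<And>k w. k \<in> orthant K \<Longrightarrow> w \<in> orthant UNIV \<Longrightarrow> d *s k + w \<in> M \<Longrightarrow> height k \<le> C * height w"
    using height_bound[OF M trivial] by blast
  define B0 B1 where "B0 = (1 + d * C) * height v" and "B1 = d * C"
  have B1: "B1 \<ge> 0" using C(1) d by (simp add: B1_def)
  have hx: "height x \<le> B0 + B1 * height y" if yx: "(y, x) \<in> pairs M (dbox d v K)" for y x
  proof -
    obtain k where k: "k \<in> orthant K" "x = v + d *s k" using yx by (auto simp: pairs_def dbox_def)
    have "height k \<le> C * height (y + v)"
      using yx k v by (intro C(2)) (auto simp: pairs_def orthant_add add_ac)
    hence "d * height k \<le> d * (C * height (y + v))" using d by (intro mult_left_mono) auto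
    thus ?thesis by (simp add: k B0_def B1_def height_add height_scale algebra_simps)
  qed
  \<comment> \<open>Small enough that $\eta(1 + 2B_1) < \varepsilon$, with the factor $2$ for strictness.\<close>
  define \<eta> where "\<eta> = \<epsilon> / (2 * (1 + 2 * B1))"
  have \<eta>: "\<eta> > 0" using eps B1 by (simp add: \<eta>_def)
  have cancel: "\<epsilon> / (2 * D) * D = \<epsilon> / 2" if "D > 0" for D :: real using that by simp
  have "real_of_int B1 \<ge> 0" using B1 by simp
  hence "\<eta> * (1 + 2 * B1) = \<epsilon> / 2" unfolding \<eta>_def using cancel[of "1 + 2 * B1"] by simp
  hence \<eta>': "\<eta> * (1 + 2 * B1) < \<epsilon>" using eps by simp
  define t1 t2 :: "complex ^ 'i"
    where "t1 = (\<chi> i. of_real (- (\<eta> * (1 + 2 * B1))))" and "t2 = (\<chi> i. of_real \<eta>)"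
  have sm: "(\<lambda>w. a (fst w) * qpow q s (fst w + snd w)) abs_summable_on pairs M (dbox d v K)"
    if s: "s \<in> tube (Lam_dual_gt (- \<eta>))" for s
  proof (rule Infinite_Sum.abs_summable_on_comparison_test)
    have "(\<lambda>(y, x). a y * qpow q t1 y * qpow q t2 x) abs_summable_on orthant UNIV \<times> orthant UNIV"
      by (intro abs_summable_on_Times a_summable summable_qpow q)
         (use \<eta> \<eta>' in \<open>auto simp: t1_def t2_def tube_gt\<close>)
    hence "(\<lambda>(y, x). a y * qpow q t1 y * qpow q t2 x) abs_summable_on pairs M (dbox d v K)"
      by (rule summable_on_subset_banach) (use dbox_subset[OF _ v, of d K] d in \<open>auto simp: pairs_def\<close>)
    hence "(\<lambda>w. real q powr (2 * \<eta> * B0) * norm (case w of (y, x) \<Rightarrow> a y * qpow q t1 y * qpow q t2 x))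
        summable_on pairs M (dbox d v K)"
      by (intro summable_on_cmult_right)
    thus "(\<lambda>w. real q powr (2 * \<eta> * B0) *\<^sub>R (case w of (y, x) \<Rightarrow> a y * qpow q t1 y * qpow q t2 x))
        abs_summable_on pairs M (dbox d v K)"
      by simp
    fix w assume w: "w \<in> pairs M (dbox d v K)"
    obtain y x where yx: "w = (y, x)" by (cases w)
    have o: "y + x \<in> orthant UNIV"
      using w dbox_subset[OF _ v, of d K] d by (auto simp: yx pairs_def intro: orthant_add)
    have "norm (qpow q s (y + x)) \<le> norm (qpow q (\<chi> i. of_real (- \<eta>)) (y + x))"
      using o s q by (intro norm_qpow_mono) (auto simp: tube_gt less_imp_le)
    also have "\<dots> = real q powr (\<eta> * (height y + height x))"
      using q by (subst norm_qpow_const) (auto simp: height_add)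
    also have "\<dots> \<le> real q powr (2 * \<eta> * B0 + \<eta> * (1 + 2 * B1) * height y - \<eta> * height x)"
    proof (rule powr_mono)
      have "real_of_int (height x) \<le> B0 + B1 * height y"
        using hx[OF w[unfolded yx]] by (metis of_int_add of_int_le_iff of_int_mult)
      hence "2 * \<eta> * height x \<le> 2 * \<eta> * (B0 + B1 * height y)" using \<eta> by (intro mult_left_mono) auto
      thus "\<eta> * (height y + height x) \<le> 2 * \<eta> * B0 + \<eta> * (1 + 2 * B1) * height y - \<eta> * height x"
        by (simp add: algebra_simps)
    qed (use q in auto)
    also have "\<dots> = real q powr (2 * \<eta> * B0) * (norm (qpow q t1 y) * norm (qpow q t2 x))"
      using q unfolding t1_def t2_def by (simp only: norm_qpow_const powr_add[symmetric]) (simp add: add_diff_eq)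
    finally have "norm (qpow q s (y + x)) \<le> real q powr (2 * \<eta> * B0) * (norm (qpow q t1 y) * norm (qpow q t2 x))" .
    hence "norm (a y) * norm (qpow q s (y + x)) \<le> norm (a y) * (real q powr (2 * \<eta> * B0) * (norm (qpow q t1 y) * norm (qpow q t2 x)))"
      by (intro mult_left_mono) auto
    thus "norm (a (fst w) * qpow q s (fst w + snd w)) \<le>
          norm (real q powr (2 * \<eta> * B0) *\<^sub>R (case w of (y, x) \<Rightarrow> a y * qpow q t1 y * qpow q t2 x))"
      by (simp add: yx norm_mult mult_ac)
  qed
  define b where "b m = (\<Sum>\<^sub>\<infinity>w\<in>{w\<in>pairs M (dbox d v K). fst w + snd w = m}. a (fst w))" for m
  have im: "(\<lambda>w. fst w + snd w) ` pairs M (dbox d v K) \<subseteq> orthant UNIV"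
    using dbox_subset[OF _ v, of d K] d by (auto simp: pairs_def intro!: orthant_add)
  show ?thesis
    unfolding elementary_admissible_0_def
  proof (intro exI[of _ b] conjI exI[of _ \<eta>] \<eta> ballI)
    fix s :: "complex ^ 'i" assume s: "s \<in> tube (Lam_dual_gt (- \<eta>))"
    show "Lser_converges UNIV Lam b (qpow q s)"
      unfolding b_def using group_by_exponent(1)[OF im sm[OF s]] q by simp
  next
    fix s :: "complex ^ 'i" assume "s \<in> tube (Lam_dual_gt 0)"
    hence s: "s \<in> tube (Lam_dual_gt (- \<eta>))" using \<eta> tube_gt_mono[of "- \<eta>" 0] by auto
    show "G (dbox d v K) s = Lser UNIV Lam b (qpow q s)"
      unfolding b_def G_def using group_by_exponent(2)[OF im sm[OF s]] q by (simp add: case_prod_unfold)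
  qed
qed

text \<open>
  The difference between a box and its translate by $p = d k_0$ is reached one unit step at a time:
  every step along $c$ with $k_{0,c} \neq 0$ removes one box with the coordinate $c$ frozen, to which the
  induction hypothesis applies. For the full translate the difference is
  $(1 - Q_p)\,G$, which recovers $G$ after division.
\<close>

lemma G_cone_sum:
  assumes d: "d > 0" and v: "v \<in> orthant UNIV"
  shows "cone_sum q (M \<inter> (*s) d ` orthant K) (G (dbox d v K))"
  using v
proof (induction "card K" arbitrary: K v rule: less_induct)
  case less
  note outer = less.hyps
  show ?case
  proof (cases "\<forall>k\<in>orthant K. d *s k \<in> M \<longrightarrow> k = 0")
    case True
    hence "elementary_admissible_0 q (G (dbox d v K))"
      using G_transversal[OF d less.prems] by blast
    thus ?thesis
      by (rule cone_sum.add[where F="{}" and H'="\<lambda>_. 0"]) (auto simp: cone_prod_def real_vector.independent_empty intro: cone_sum.zero)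
  next
    case False
    then obtain k0 where k0: "k0 \<in> orthant K" "d *s k0 \<in> M" "k0 \<noteq> 0" by blast
    define p where "p = d *s k0"
    have pM: "p \<in> M" using k0 by (simp add: p_def)
    have po: "p \<in> orthant UNIV" using k0(1) d by (auto simp: p_def orthant_def)
    have "p \<noteq> 0" using k0(3) d by (auto simp: p_def vec_eq_iff)
    have vo: "v + d *s e \<in> orthant UNIV" if "e \<in> orthant K" for e
      using that less.prems d by (auto simp: orthant_def)
    have tele: "cone_sum q (M \<inter> (*s) d ` orthant K)
        (\<lambda>s. (G (dbox d v K) s - G (dbox d (v + d *s e) K) s) / (1 - qpow q s p))"
      if "e \<in> orthant {c. k0 $ c \<noteq> 0}" for e
      using that
    proof (induction "nat (height e)" arbitrary: e rule: less_induct)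
      case (less e)
      show ?case
      proof (cases "e = 0")
        case True
        thus ?thesis by (auto intro: cone_sum.zero)
      next
        case False
        then obtain c where c: "e $ c \<noteq> 0" by (auto simp: vec_eq_iff)
        hence k0c: "k0 $ c \<noteq> 0" using less.prems by (auto simp: orthant_def)
        hence cK: "c \<in> K" using k0(1) by (auto simp: orthant_def)
        have "c' \<in> K" if "k0 $ c' \<noteq> 0" for c' using that k0(1) by (auto simp: orthant_def)
        hence sub: "orthant {c. k0 $ c \<noteq> 0} \<subseteq> orthant K" by (intro orthant_mono) auto
        define e' where "e' = e - axis c 1"
        have e': "e' \<in> orthant {c. k0 $ c \<noteq> 0}"
          using orthantD[OF less.prems] c k0c by (auto simp: e'_def orthant_def axis_def)
            (metis antisym_conv2 int_one_le_iff_zero_less)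
        have ee: "v + d *s e = (v + d *s e') + d *s axis c 1"
          by (simp add: e'_def vec_eq_iff algebra_simps)
        have "height e = height e' + height (axis c 1)" by (simp add: e'_def flip: height_add)
        also have "height (axis c 1) = 1" by (simp add: height_def axis_def)
        finally have "nat (height e') < nat (height e)" using height_nonneg[OF e'] by simp
        note IH = less.hyps[OF this e']
        have "card (K - {c}) < card K" using cK by (intro psubset_card_mono) auto
        note IH' = outer[OF this vo]
        have "cone_sum q (M \<inter> (*s) d ` orthant K) (\<lambda>s. G (dbox d (v + d *s e') (K - {c})) s / (1 - qpow q s p))"
        proof (rule cone_sum_divide[OF IH' q])
          show "e' \<in> orthant K" using e' sub by blast
          show "M \<inter> (*s) d ` orthant (K - {c}) \<subseteq> M \<inter> (*s) d ` orthant K"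
            using orthant_mono[of "K - {c}" K] by blast
          show "x $ c = 0" if "x \<in> M \<inter> (*s) d ` orthant (K - {c})" for x
            using that by (auto simp: orthant_def)
          show "p \<in> M \<inter> (*s) d ` orthant K" using k0 by (simp add: p_def)
          show "p $ c \<noteq> 0" using k0c d by (simp add: p_def)
        qed (rule po)
        from cone_sum_plus[OF IH this] show ?thesis
        proof (rule cone_sum_cong)
          fix s :: "complex ^ 'i" assume s: "s \<in> tube (Lam_dual_gt 0)"
          have "G (dbox d (v + d *s e') K) s = G (dbox d (v + d *s e') (K - {c})) s + G (dbox d (v + d *s e) K) s"
            unfolding ee dbox_split(1)[OF d cK, of "v + d *s e'"]
          proof (rule G_Un[OF _ _ dbox_split(2)[OF d cK] s])
            show "dbox d (v + d *s e') (K - {c}) \<subseteq> orthant UNIV"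
              using d vo e' sub by (intro dbox_subset) auto
            show "dbox d (v + d *s e' + d *s axis c 1) K \<subseteq> orthant UNIV"
              unfolding ee[symmetric] using d vo less.prems sub by (intro dbox_subset) auto
          qed
          thus "(G (dbox d v K) s - G (dbox d (v + d *s e) K) s) / (1 - qpow q s p) =
            (G (dbox d v K) s - G (dbox d (v + d *s e') K) s) / (1 - qpow q s p) +
            G (dbox d (v + d *s e') (K - {c})) s / (1 - qpow q s p)"
            by (simp add: add_divide_distrib[symmetric])
        qed
      qed
    qed
    have "k0 \<in> orthant {c. k0 $ c \<noteq> 0}" using k0(1) by (auto simp: orthant_def)
    from tele[OF this] show ?thesis
    proof (rule cone_sum_cong)
      fix s :: "complex ^ 'i" assume s: "s \<in> tube (Lam_dual_gt 0)"
      have "norm (qpow q s p) < 1" using q po s \<open>p \<noteq> 0\<close> by (intro norm_qpow_lt_1) auto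
      hence "qpow q s p \<noteq> 1" by auto
      moreover have "dbox d (v + d *s k0) K = (\<lambda>x. x + p) ` dbox d v K"
        by (auto simp: dbox_def p_def image_image add_ac)
      hence "G (dbox d (v + d *s k0) K) s = qpow q s p * G (dbox d v K) s"
        using G_shift[OF pM] by simp
      ultimately show "G (dbox d v K) s = (G (dbox d v K) s - G (dbox d (v + d *s k0) K) s) / (1 - qpow q s p)"
        by (simp add: field_simps)
    qed
  qed
qed

end

section \<open>Simplicial cones\<close>

definition pos_combos :: "(int ^ 'i) set \<Rightarrow> (int ^ 'i) set" where
  "pos_combos F = {\<Sum>p\<in>F. k p *s p | k. \<forall>p\<in>F. (1::int) \<le> k p}"

definition int_combos :: "(int ^ 'i) set \<Rightarrow> (int ^ 'i) set" where
  "int_combos F = {\<Sum>p\<in>F. k p *s p | k :: int ^ 'i \<Rightarrow> int. True}"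

lemma pos_combosI: "(\<And>p. p \<in> F \<Longrightarrow> (1::int) \<le> k p) \<Longrightarrow> (\<Sum>p\<in>F. k p *s p) \<in> pos_combos F"
  unfolding pos_combos_def by blast

lemma pos_combosE:
  assumes "x \<in> pos_combos F"
  obtains k where "\<And>p. p \<in> F \<Longrightarrow> (1::int) \<le> k p" "x = (\<Sum>p\<in>F. k p *s p)"
  using assms unfolding pos_combos_def by blast

lemma pos_combos_empty [simp]: "pos_combos {} = {0}"
  by (simp add: pos_combos_def)

lemma pos_combos_orthant:
  assumes "F \<subseteq> orthant K"
  shows "pos_combos F \<subseteq> orthant K"
proof -
  have "(\<Sum>p\<in>F. k p *s p) \<in> orthant K" if k: "\<forall>p\<in>F. (1::int) \<le> k p" for k
  proof -
    have "0 \<le> k p * p $ i" if "p \<in> F" for p i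
      using that k assms orthantD(1)[of p K i] by (intro mult_nonneg_nonneg) force+
    moreover have "k p * p $ i = 0" if "p \<in> F" "i \<notin> K" for p i
      using that assms orthantD(2)[of p K i] by auto
    ultimately show ?thesis
      by (auto simp: orthant_def intro!: sum_nonneg sum.neutral)
  qed
  thus ?thesis by (auto simp: pos_combos_def)
qed

lemma pos_combos_span: "x \<in> pos_combos F \<Longrightarrow> in_NR x \<in> span (in_NR ` F)"
  by (erule pos_combosE) (auto simp: in_NR_sum in_NR_scale intro!: span_sum span_scale intro: span_base)

text \<open>
  Subtract \<open>p\<close> once: its multiplicity either stays positive or drops to zero. On the level of
  series this is a linear equation for the series of \<open>insert p F\<close>.
\<close>

lemma pos_combos_insert:
  assumes F: "finite F" "p \<notin> F"
  shows "pos_combos (insert p F) = (\<lambda>x. x + p) ` (pos_combos (insert p F) \<union> pos_combos F)"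
proof (intro equalityI subsetI)
  fix x assume "x \<in> pos_combos (insert p F)"
  then obtain k where k: "\<And>r. r \<in> insert p F \<Longrightarrow> (1::int) \<le> k r" "x = (\<Sum>r\<in>insert p F. k r *s r)"
    by (blast elim: pos_combosE)
  have x: "x = ((k p - 1) *s p + (\<Sum>r\<in>F. k r *s r)) + p"
    using F by (simp add: k(2) vec_eq_iff algebra_simps)
  show "x \<in> (\<lambda>x. x + p) ` (pos_combos (insert p F) \<union> pos_combos F)"
  proof (cases "k p = 1")
    case True
    thus ?thesis using x k(1) pos_combosI[of F k] by auto
  next
    case False
    define l where "l = k(p := k p - 1)"
    have "(k p - 1) *s p + (\<Sum>r\<in>F. k r *s r) = (\<Sum>r\<in>insert p F. l r *s r)"
      using F by (auto simp: l_def intro!: sum.cong)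
    moreover have "\<forall>r\<in>insert p F. 1 \<le> l r" using False k(1) by (force simp: l_def)
    ultimately have "(k p - 1) *s p + (\<Sum>r\<in>F. k r *s r) \<in> pos_combos (insert p F)"
      unfolding pos_combos_def by blast
    thus ?thesis using x by blast
  qed
next
  fix x assume "x \<in> (\<lambda>x. x + p) ` (pos_combos (insert p F) \<union> pos_combos F)"
  then obtain y where y: "y \<in> pos_combos (insert p F) \<union> pos_combos F" "x = y + p" by blast
  have "\<exists>k. (\<forall>r\<in>F. (1::int) \<le> k r) \<and> 0 \<le> k p \<and> y = (\<Sum>r\<in>insert p F. k r *s r)"
  proof (cases "y \<in> pos_combos F")
    case False
    with y(1) have "y \<in> pos_combos (insert p F)" by blast
    then obtain k where k: "\<And>r. r \<in> insert p F \<Longrightarrow> (1::int) \<le> k r" "y = (\<Sum>r\<in>insert p F. k r *s r)"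
      by (blast elim: pos_combosE)
    have "1 \<le> k p" using k(1) by blast
    hence "0 \<le> k p" by linarith
    with k show ?thesis by (intro exI[of _ k]) blast
  next
    case True
    then obtain k where k: "\<And>r. r \<in> F \<Longrightarrow> (1::int) \<le> k r" "y = (\<Sum>r\<in>F. k r *s r)"
      by (blast elim: pos_combosE)
    have "y = (\<Sum>r\<in>insert p F. (k(p := 0)) r *s r)"
      using F by (auto simp: k(2) intro!: sum.cong)
    moreover have "\<forall>r\<in>F. 1 \<le> (k(p := 0)) r" using F k(1) by auto
    ultimately show ?thesis by (intro exI[of _ "k(p := 0)"]) simp
  qed
  then obtain k where k: "\<forall>r\<in>F. (1::int) \<le> k r" "0 \<le> k p" "y = (\<Sum>r\<in>insert p F. k r *s r)"
    by blast
  define l where "l = k(p := k p + 1)"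
  have "x = (\<Sum>r\<in>insert p F. l r *s r)"
  proof -
    have "(\<Sum>r\<in>F. l r *s r) = (\<Sum>r\<in>F. k r *s r)" using F by (auto simp: l_def intro!: sum.cong)
    thus ?thesis using F by (simp add: y(2) k(3) l_def vec_eq_iff algebra_simps)
  qed
  moreover have "1 \<le> l r" if "r \<in> insert p F" for r using that k(1,2) by (auto simp: l_def)
  ultimately show "x \<in> pos_combos (insert p F)" using pos_combosI[of "insert p F" l] by simp
qed

lemma pos_combos_disjoint:
  assumes F: "finite F" "p \<notin> F" and ind: "independent (in_NR ` insert p F)"
  shows "pos_combos (insert p F) \<inter> pos_combos F = {}"
proof (rule ccontr)
  assume "pos_combos (insert p F) \<inter> pos_combos F \<noteq> {}"
  then obtain x where x: "x \<in> pos_combos (insert p F)" "x \<in> pos_combos F" by blast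
  then obtain k where k: "\<And>r. r \<in> insert p F \<Longrightarrow> (1::int) \<le> k r" "x = (\<Sum>r\<in>insert p F. k r *s r)"
    by (blast elim: pos_combosE)
  have "in_NR x = of_int (k p) *\<^sub>R in_NR p + in_NR (\<Sum>r\<in>F. k r *s r)"
    using F by (simp add: k(2) in_NR_add in_NR_scale)
  moreover have "in_NR (\<Sum>r\<in>F. k r *s r) \<in> span (in_NR ` F)"
    using k(1) by (intro pos_combos_span pos_combosI) auto
  ultimately have "of_int (k p) *\<^sub>R in_NR p \<in> span (in_NR ` F)"
    using span_diff[OF pos_combos_span[OF x(2)], of "in_NR (\<Sum>r\<in>F. k r *s r)"] by simp
  moreover have "real_of_int (k p) \<noteq> 0" using k(1)[of p] by simp
  ultimately have "in_NR p \<in> span (in_NR ` F)"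
    using span_scale[of "of_int (k p) *\<^sub>R in_NR p" _ "1 / of_int (k p)"] by simp
  moreover have "in_NR p \<notin> in_NR ` F" using F by (simp add: inj_image_mem_iff[OF inj_in_NR])
  ultimately show False using ind by (simp add: independent_insert)
qed

lemma cone_prod_series:
  assumes "finite F" "F \<subseteq> orthant UNIV" "independent (in_NR ` F)"
    and q: "q > 1" and s: "s \<in> tube (Lam_dual_gt 0)"
  shows "(\<Sum>\<^sub>\<infinity>x\<in>pos_combos F. qpow q s x) = cone_prod q F s"
  using assms(1-3)
proof (induction F rule: finite_induct)
  case empty
  thus ?case using q by (simp add: cone_prod_def)
next
  case (insert p F)
  have ind: "independent (in_NR ` F)"
    using insert.prems(2) by (rule independent_mono) auto
  have sm: "qpow q s summable_on pos_combos E" if "E \<subseteq> orthant UNIV" for E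
    by (rule summable_on_subset_banach[OF abs_summable_summable[OF summable_qpow[OF q s]] pos_combos_orthant[OF that]])
  have po: "p \<in> orthant UNIV" using insert.prems by auto
  have "in_NR p \<noteq> 0"
    using insert.prems(2) real_vector.dependent_zero by (metis image_insert insertI1)
  hence "p \<noteq> 0" by auto
  hence "norm (qpow q s p) < 1" using q s po by (intro norm_qpow_lt_1) auto
  hence Q: "qpow q s p \<noteq> 1" by auto
  let ?S = "\<lambda>E. \<Sum>\<^sub>\<infinity>x\<in>pos_combos E. qpow q s x"
  have "?S (insert p F) = (\<Sum>\<^sub>\<infinity>x\<in>pos_combos (insert p F) \<union> pos_combos F. qpow q s (x + p))"
    by (subst pos_combos_insert[OF insert.hyps], subst infsum_reindex) (auto simp: o_def)
  also have "\<dots> = (\<Sum>\<^sub>\<infinity>x\<in>pos_combos (insert p F) \<union> pos_combos F. qpow q s x) * qpow q s p"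
    using q by (simp add: qpow_add infsum_cmult_left')
  also have "(\<Sum>\<^sub>\<infinity>x\<in>pos_combos (insert p F) \<union> pos_combos F. qpow q s x) = ?S (insert p F) + ?S F"
    using insert.prems by (intro infsum_Un_disjoint sm pos_combos_disjoint insert.hyps) auto
  finally have eq: "?S (insert p F) = (?S (insert p F) + ?S F) * qpow q s p" .
  have "A * (1 - Q) = Q * B" if "A = (A + B) * Q" for A B Q :: complex
  proof -
    have "A * (1 - Q) = A - A * Q" by (simp add: right_diff_distrib)
    also have "\<dots> = Q * B" using that by (metis add_diff_cancel_left' distrib_right mult.commute)
    finally show ?thesis .
  qed
  from this[OF eq] have "?S (insert p F) * (1 - qpow q s p) = qpow q s p * ?S F" .
  moreover have "1 - qpow q s p \<noteq> 0" using Q by simp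
  ultimately have "?S (insert p F) = qpow q s p * ?S F / (1 - qpow q s p)"
    by (metis nonzero_mult_div_cancel_right)
  hence "?S (insert p F) = qpow q s p / (1 - qpow q s p) * ?S F" by simp
  thus ?case using insert ind by (simp add: cone_prod_def)
qed

lemma int_combos_subgroup: "subgroup (int_combos F) Ngrp"
  unfolding subgroup_Ngrp_iff
proof (intro conjI ballI)
  show "0 \<in> int_combos F"
    unfolding int_combos_def by (intro CollectI exI[of _ "\<lambda>_. 0"]) simp
next
  fix x y assume "x \<in> int_combos F" "y \<in> int_combos F"
  then obtain k l where "x = (\<Sum>p\<in>F. k p *s p)" "y = (\<Sum>p\<in>F. l p *s p)"
    unfolding int_combos_def by blast
  hence "x + y = (\<Sum>p\<in>F. (k p + l p) *s p)"
    by (simp add: sum.distrib vector_sadd_rdistrib)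
  thus "x + y \<in> int_combos F" unfolding int_combos_def by (intro CollectI exI[of _ "\<lambda>p. k p + l p"]) simp
next
  fix x assume "x \<in> int_combos F"
  then obtain k where "x = (\<Sum>p\<in>F. k p *s p)"
    unfolding int_combos_def by blast
  hence "- x = (\<Sum>p\<in>F. (- k p) *s p)"
    by (simp add: sum_negf[symmetric] vec_eq_iff)
  thus "- x \<in> int_combos F" unfolding int_combos_def by (intro CollectI exI[of _ "\<lambda>p. - k p"]) simp
qed

text \<open>
  A simplicial cone is the sum of its rays, and relative interiors are compatible with sums of
  convex sets.
\<close>

lemma rel_interior_simplicial_cone:
  assumes "finite F" "independent (in_NR ` F)"
  shows "rel_interior (cone_gen F) = {\<Sum>p\<in>F. t p *\<^sub>R in_NR p | t. \<forall>p\<in>F. (0::real) < t p}"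
  using assms
proof (induction F rule: finite_induct)
  case empty
  show ?case by (simp add: cone_gen_def)
next
  case (insert p F)
  have ind: "independent (in_NR ` F)"
    using insert.prems by (rule independent_mono) auto
  have p0: "in_NR p \<noteq> 0"
    using insert.prems real_vector.dependent_zero by (metis image_insert insertI1)
  have ray: "convex_cone hull {in_NR p} = (\<lambda>t. t *\<^sub>R in_NR p) ` {0..}"
    by (auto simp: convex_cone_hull_convex_hull intro: image_eqI[of _ _ 0])
  have "rel_interior ((\<lambda>t. t *\<^sub>R in_NR p) ` {0..}) = (\<lambda>t. t *\<^sub>R in_NR p) ` rel_interior {0::real..}"
    using p0 by (intro rel_interior_injective_on_span_linear_image bounded_linear_scaleR_left) (auto simp: inj_on_def)
  also have "rel_interior {0::real..} = {0<..}"
    by (subst rel_interior_nonempty_interior) (auto simp: interior_real_atLeast)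
  finally have relray: "rel_interior (convex_cone hull {in_NR p}) = (\<lambda>t. t *\<^sub>R in_NR p) ` {0<..}"
    by (simp add: ray)
  have "cone_gen (insert p F) = convex_cone hull {in_NR p} + cone_gen F"
    unfolding cone_gen_def set_plus_def using convex_cone_hull_Un[of "{in_NR p}" "in_NR ` F"] by auto
  hence "rel_interior (cone_gen (insert p F)) = (\<lambda>t. t *\<^sub>R in_NR p) ` {0<..} + rel_interior (cone_gen F)"
    by (simp add: rel_interior_sum cone_gen_def convex_convex_cone_hull relray)
  also have "\<dots> = (\<lambda>t. t *\<^sub>R in_NR p) ` {0<..} + {\<Sum>p\<in>F. t p *\<^sub>R in_NR p | t. \<forall>p\<in>F. (0::real) < t p}"
    using insert.IH ind by simp
  also have "\<dots> = {\<Sum>p\<in>insert p F. t p *\<^sub>R in_NR p | t. \<forall>p\<in>insert p F. (0::real) < t p}"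
  proof (intro equalityI subsetI)
    fix x assume "x \<in> (\<lambda>t. t *\<^sub>R in_NR p) ` {0<..} + {\<Sum>p\<in>F. t p *\<^sub>R in_NR p | t. \<forall>p\<in>F. (0::real) < t p}"
    then obtain c t where t: "(0::real) < c" "\<forall>r\<in>F. (0::real) < t r" "x = c *\<^sub>R in_NR p + (\<Sum>r\<in>F. t r *\<^sub>R in_NR r)"
      by (auto simp: set_plus_def)
    have "(\<Sum>r\<in>F. t r *\<^sub>R in_NR r) = (\<Sum>r\<in>F. (t(p := c)) r *\<^sub>R in_NR r)"
      using insert.hyps by (intro sum.cong) auto
    hence "x = (\<Sum>r\<in>insert p F. (t(p := c)) r *\<^sub>R in_NR r)"
      using insert.hyps t(3) by simp
    moreover have "\<forall>r\<in>insert p F. 0 < (t(p := c)) r" using t by auto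
    ultimately show "x \<in> {\<Sum>p\<in>insert p F. t p *\<^sub>R in_NR p | t. \<forall>p\<in>insert p F. (0::real) < t p}" by blast
  next
    fix x assume "x \<in> {\<Sum>p\<in>insert p F. t p *\<^sub>R in_NR p | t. \<forall>p\<in>insert p F. (0::real) < t p}"
    then obtain t where "\<forall>r\<in>insert p F. (0::real) < t r" "x = (\<Sum>r\<in>insert p F. t r *\<^sub>R in_NR r)" by blast
    thus "x \<in> (\<lambda>t. t *\<^sub>R in_NR p) ` {0<..} + {\<Sum>p\<in>F. t p *\<^sub>R in_NR p | t. \<forall>p\<in>F. (0::real) < t p}"
      using insert.hyps by (auto simp: set_plus_def)
  qed
  finally show ?case .
qed

text \<open>
  A point of the lattice spanned by \<open>F\<close> that is a positive real combination of \<open>F\<close> has, by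
  independence, its integral coefficients equal to the positive real ones, hence at least $1$.
\<close>

lemma lattice_pts_rel_interior:
  assumes F: "finite F" and ind: "independent (in_NR ` F)"
  shows "lattice_pts (int_combos F) (rel_interior (cone_gen F)) = pos_combos F"
proof (intro equalityI subsetI)
  fix x assume x: "x \<in> lattice_pts (int_combos F) (rel_interior (cone_gen F))"
  then obtain k :: "int ^ 'a \<Rightarrow> int" and t :: "int ^ 'a \<Rightarrow> real"
    where k: "x = (\<Sum>p\<in>F. k p *s p)" and t: "\<forall>p\<in>F. 0 < t p" "in_NR x = (\<Sum>p\<in>F. t p *\<^sub>R in_NR p)"
    unfolding lattice_pts_def int_combos_def rel_interior_simplicial_cone[OF F ind] by blast
  define u where "u w = (let p = inv_into UNIV in_NR w in of_int (k p) - t p)" for w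
  have "(\<Sum>w\<in>in_NR ` F. u w *\<^sub>R w) = (\<Sum>p\<in>F. (of_int (k p) - t p) *\<^sub>R in_NR p)"
    by (subst sum.reindex) (auto intro: inj_on_subset[OF inj_in_NR] simp: u_def inv_f_f[OF inj_in_NR])
  also have "\<dots> = in_NR x - in_NR x"
    by (subst (1) k, subst t(2)) (simp add: in_NR_sum in_NR_scale scaleR_left_diff_distrib sum_subtractf)
  finally have "(\<Sum>w\<in>in_NR ` F. u w *\<^sub>R w) = 0" by simp
  hence "u (in_NR p) = 0" if "p \<in> F" for p
    using real_vector.independentD[OF ind _ subset_refl, of u "in_NR p"] F that by simp
  hence "of_int (k p) = t p" if "p \<in> F" for p
    using that by (simp add: u_def inv_f_f[OF inj_in_NR])
  hence "\<forall>p\<in>F. 1 \<le> k p" using t(1) by (metis int_one_le_iff_zero_less of_int_0_less_iff)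
  thus "x \<in> pos_combos F" unfolding k by (intro pos_combosI) auto
next
  fix x assume "x \<in> pos_combos F"
  then obtain k where k: "\<And>p. p \<in> F \<Longrightarrow> (1::int) \<le> k p" "x = (\<Sum>p\<in>F. k p *s p)" by (blast elim: pos_combosE)
  have "in_NR x = (\<Sum>p\<in>F. of_int (k p) *\<^sub>R in_NR p)" "\<forall>p\<in>F. (0::real) < of_int (k p)"
    using k(1) by (force simp: k(2) in_NR_sum in_NR_scale)+
  hence "in_NR x \<in> rel_interior (cone_gen F)"
    unfolding rel_interior_simplicial_cone[OF F ind]
    by (intro CollectI exI[of _ "\<lambda>p. of_int (k p)"] conjI)
  thus "x \<in> lattice_pts (int_combos F) (rel_interior (cone_gen F))"
    using k(2) unfolding lattice_pts_def int_combos_def by blast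
qed

lemma cone_gen_subset_Lam: "F \<subseteq> orthant UNIV \<Longrightarrow> cone_gen F \<subseteq> Lam"
  unfolding cone_gen_def
proof (rule hull_minimal)
  have L: "Lam = {x :: real ^ 'a. \<forall>i. 0 \<le> x $ i}"
    unfolding Lam_def using coordinate_cone[of UNIV] by auto
  show "in_NR ` F \<subseteq> Lam" if "F \<subseteq> orthant UNIV" for F :: "(int ^ 'a) set"
    using that by (auto simp: L orthant_def)
  show "convex_cone (Lam :: (real ^ 'a) set)"
    by (auto simp: Lam_def cone_gen_def convex_cone_convex_cone_hull)
qed

lemma dim_cone_gen: "dim (cone_gen F) \<le> dim (in_NR ` F)"
proof -
  have "cone_gen F \<subseteq> span (in_NR ` F)"
    unfolding cone_gen_def by (intro hull_minimal span_superset convex_cone_span)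
  thus ?thesis by (metis dim_span dim_subset)
qed

lemma holomorphic_cone_prod:
  assumes "finite F" "F \<subseteq> orthant UNIV" "independent (in_NR ` F)" "q > 1"
  shows "holomorphic_several (cone_prod q F) (tube (Lam_dual_gt 0))"
proof -
  define b where "b x = (of_bool (x \<in> pos_combos F) :: complex)" for x
  have "Lser_converges UNIV Lam b (qpow q s)" if "s \<in> tube (Lam_dual_gt 0)" for s
    unfolding Lser_converges_Lam
    by (rule Infinite_Sum.abs_summable_on_comparison_test[OF summable_qpow[OF assms(4) that]]) (auto simp: b_def)
  from holomorphic_Lser[OF assms(4) this] show ?thesis
  proof (rule holomorphic_several_cong)
    fix s :: "complex ^ 'a" assume s: "s \<in> tube (Lam_dual_gt 0)"
    have "Lser UNIV Lam b (qpow q s) = (\<Sum>\<^sub>\<infinity>x\<in>pos_combos F. qpow q s x)"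
      unfolding Lser_Lam using pos_combos_orthant[OF assms(2)]
      by (intro infsum_cong_neutral) (auto simp: b_def)
    thus "Lser UNIV Lam b (qpow q s) = cone_prod q F s"
      using cone_prod_series[OF assms s] by simp
  qed
qed

lemma holomorphic_elementary_0:
  assumes "elementary_admissible_0 q g" "q > 1"
  shows "holomorphic_several g (tube (Lam_dual_gt 0))"
proof -
  from assms(1) obtain b \<eta> where b: "\<eta> > 0"
    "\<forall>s\<in>tube (Lam_dual_gt (- \<eta>)). Lser_converges UNIV Lam b (qpow q s)"
    "\<forall>s\<in>tube (Lam_dual_gt 0). g s = Lser UNIV Lam b (qpow q s)"
    unfolding elementary_admissible_0_def by auto
  have "Lser_converges UNIV Lam b (qpow q s)" if "s \<in> tube (Lam_dual_gt 0)" for s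
    using b(1,2) that tube_gt_mono[of "- \<eta>" 0] by auto
  from holomorphic_Lser[OF assms(2) this] show ?thesis
  proof (rule holomorphic_several_cong)
    fix s :: "complex ^ 'a" assume s: "s \<in> tube (Lam_dual_gt 0)"
    show "Lser UNIV Lam b (qpow q s) = g s" by (rule b(3)[rule_format, OF s, symmetric])
  qed
qed

text \<open>
  In multiplicity $0$ no cone is allowed; there the dimension bound forces \<open>F\<close> to be empty.
\<close>

lemma elementary_admissible_term:
  assumes g: "elementary_admissible_0 q g" and F: "finite F" "F \<subseteq> orthant UNIV" "independent (in_NR ` F)"
    and q: "q > 1" and r: "dim (in_NR ` F) \<le> r"
  shows "elementary_admissible q r (\<lambda>s. g s * cone_prod q F s)"
proof (cases "r = 0")
  case True
  have "in_NR ` F \<subseteq> {0}" using r True by (simp add: dim_eq_0)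
  hence "in_NR ` F = {}" using F(3) real_vector.dependent_zero by (metis insertI1 subset_singletonD)
  hence "F = {}" by simp
  thus ?thesis using g True by (simp add: elementary_admissible_def cone_prod_def)
next
  case False
  have "elementary_admissible_pos q r (\<lambda>s. g s * cone_prod q F s)"
    unfolding elementary_admissible_pos_def
  proof (intro conjI exI[of _ g] exI[of _ "cone_gen F"] exI[of _ "int_combos F"] ballI)
    show "holomorphic_several (\<lambda>s. g s * cone_prod q F s) (tube (Lam_dual_gt 0))"
      by (intro holomorphic_several_mult holomorphic_elementary_0[OF g q] holomorphic_cone_prod F q)
    show "rational_polyhedral_cone (cone_gen F)"
      using F(1) by (auto simp: rational_polyhedral_cone_def)
    show "dim (cone_gen F) \<le> r" using dim_cone_gen[of F] r by simp
    show "g s * cone_prod q F s = g s * Lser (int_combos F) (rel_interior (cone_gen F)) (\<lambda>_. 1) (qpow q s)"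
      if "s \<in> tube (Lam_dual_gt 0)" for s
      using cone_prod_series[OF F q that] by (simp add: Lser_def lattice_pts_rel_interior[OF F(1,3)])
  qed (use g F int_combos_subgroup cone_gen_subset_Lam in auto)
  thus ?thesis using False by (simp add: elementary_admissible_def)
qed

lemma cone_sum_admissible:
  assumes "cone_sum q A H" and q: "q > 1" and A: "A \<subseteq> orthant UNIV"
    and r: "\<And>F. F \<subseteq> A \<Longrightarrow> dim (in_NR ` F) \<le> r"
  shows "admissible q (- int r) H"
proof -
  have "\<exists>(K::nat) F. (\<forall>k<K. elementary_admissible q r (F k)) \<and>
          (\<forall>s\<in>tube (Lam_dual_gt 0). H s = (\<Sum>k<K. F k s))"
    using assms(1)
  proof induction
    case (zero H)
    thus ?case by (intro exI[of _ "0::nat"]) auto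
  next
    case (add g E H' H)
    from add.IH obtain K :: nat and F where F: "\<forall>k<K. elementary_admissible q r (F k)"
      "\<forall>s\<in>tube (Lam_dual_gt 0). H' s = (\<Sum>k<K. F k s)" by blast
    define F' where "F' = F(K := \<lambda>s. g s * cone_prod q E s)"
    have "elementary_admissible q r (\<lambda>s. g s * cone_prod q E s)"
      using add.hyps A r q by (intro elementary_admissible_term) auto
    hence "\<forall>k<Suc K. elementary_admissible q r (F' k)"
      using F(1) by (auto simp: F'_def less_Suc_eq)
    moreover have "(\<Sum>k<Suc K. F' k s) = g s * cone_prod q E s + (\<Sum>k<K. F k s)" for s
    proof -
      have "(\<Sum>k<K. F' k s) = (\<Sum>k<K. F k s)" by (intro sum.cong) (auto simp: F'_def)
      thus ?thesis by (simp add: F'_def)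
    qed
    hence "\<forall>s\<in>tube (Lam_dual_gt 0). H s = (\<Sum>k<Suc K. F' k s)"
      using F(2) add.hyps(6) by simp
    ultimately show ?case by blast
  qed
  thus ?thesis unfolding admissible_def by auto
qed

section \<open>Characters of the quotient\<close>

lemma normal_Ngrp: "subgroup M Ngrp \<Longrightarrow> M \<lhd> Ngrp"
  by (rule comm_group.subgroup_imp_normal[OF comm_group_Ngrp])

lemma quot_map_eq: "quot_map M y = {m + y | m. m \<in> M}"
  by (auto simp: quot_map_def r_coset_def)

lemma quot_map_eq_iff:
  assumes "subgroup M Ngrp"
  shows "quot_map M x = quot_map M y \<longleftrightarrow> x - y \<in> M"
proof
  assume "quot_map M x = quot_map M y"
  moreover have "x \<in> quot_map M x"
    using subgroup_NgrpD(1)[OF assms] by (force simp: quot_map_eq)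
  ultimately obtain m where "m \<in> M" "x = m + y" by (auto simp: quot_map_eq)
  thus "x - y \<in> M" by simp
next
  assume d: "x - y \<in> M"
  show "quot_map M x = quot_map M y"
  proof (intro equalityI subsetI)
    fix u assume "u \<in> quot_map M x"
    then obtain m where "m \<in> M" "u = m + x" by (auto simp: quot_map_eq)
    hence "m + (x - y) \<in> M" "u = (m + (x - y)) + y"
      using subgroup_NgrpD(2)[OF assms _ d] by auto
    thus "u \<in> quot_map M y" unfolding quot_map_eq by blast
  next
    fix u assume "u \<in> quot_map M y"
    then obtain m where "m \<in> M" "u = m + y" by (auto simp: quot_map_eq)
    hence "m - (x - y) \<in> M" "u = (m - (x - y)) + x"
      using subgroup_NgrpD(4)[OF assms _ d] by auto
    thus "u \<in> quot_map M x" unfolding quot_map_eq by blast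
  qed
qed

lemma quot_map_0: "quot_map M 0 = M"
  by (simp add: quot_map_eq)

lemma carrier_Mod: "carrier (Ngrp Mod M) = range (quot_map M)"
  by (auto simp: FactGroup_def RCOSETS_def quot_map_def)

lemma quot_map_add:
  assumes "subgroup M Ngrp"
  shows "quot_map M x <#>\<^bsub>Ngrp\<^esub> quot_map M y = quot_map M (x + y)"
  using normal.rcos_sum[OF normal_Ngrp[OF assms], of x y] by (simp add: quot_map_def)

lemma one_Mod: "\<one>\<^bsub>Ngrp Mod M\<^esub> = M"
  by (simp add: FactGroup_def)

lemma quot_map_pow:
  assumes "subgroup M Ngrp"
  shows "quot_map M x [^]\<^bsub>Ngrp Mod M\<^esub> (n::nat) = quot_map M (int n *s x)"
proof (induction n)
  case 0
  show ?case by (simp add: nat_pow_def one_Mod quot_map_0)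
next
  case (Suc n)
  have "quot_map M x [^]\<^bsub>Ngrp Mod M\<^esub> Suc n = quot_map M (int n *s x) \<otimes>\<^bsub>Ngrp Mod M\<^esub> quot_map M x"
    using Suc by (simp add: nat_pow_def)
  also have "\<dots> = quot_map M (int (Suc n) *s x)"
    by (simp add: quot_map_add[OF assms] vector_sadd_rdistrib add.commute)
  finally show ?case .
qed

text \<open>
  Functions on the quotient are built by evaluating at a chosen representative of the coset.
\<close>

lemma descend:
  assumes "subgroup M Ngrp" "\<And>x y. x - y \<in> M \<Longrightarrow> f x = f y"
  shows "f (SOME u. u \<in> quot_map M x) = f x"
proof -
  have "x \<in> quot_map M x"
    using subgroup_NgrpD(1)[OF assms(1)] by (force simp: quot_map_eq)
  hence "(SOME u. u \<in> quot_map M x) \<in> quot_map M x" by (rule someI)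
  then obtain m where "m \<in> M" "(SOME u. u \<in> quot_map M x) = m + x"
    by (auto simp: quot_map_eq)
  thus ?thesis using assms(2)[of "m + x" x] by simp
qed

lemma torsion_freeD:
  assumes M: "subgroup M Ngrp" and tf: "torsion_free_group (Ngrp Mod M)"
    and n: "n > 0" "n *s y \<in> M"
  shows "y \<in> M"
proof -
  have "quot_map M y [^]\<^bsub>Ngrp Mod M\<^esub> nat n = quot_map M (n *s y)"
    using n(1) by (simp add: quot_map_pow[OF M])
  also have "\<dots> = M"
    using quot_map_eq_iff[OF M, of "n *s y" 0] n(2) by (simp add: quot_map_0)
  finally have "quot_map M y = M"
    using tf[unfolded torsion_free_group_def one_Mod carrier_Mod, rule_format, of "quot_map M y" "nat n"] n(1)
    by simp
  thus "y \<in> M" using quot_map_eq_iff[OF M, of y 0] by (simp add: quot_map_0)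
qed

text \<open>
  If $y = \sum r_i g_i$ with real $r_i$ and $g_i \in M$, simultaneous Dirichlet approximation
  gives $q > 0$ and integers $p_i$ with all $q r_i - p_i$ so small that the integral vector
  $q y - \sum p_i g_i$ has coordinates of absolute value less than $1$. Hence $q y \in M$, and
  $y \in M$ because the quotient is torsion-free.
\<close>

lemma saturated:
  assumes M: "subgroup M Ngrp" and tf: "torsion_free_group (Ngrp Mod M)"
    and y: "in_NR y \<in> span (in_NR ` M)"
  shows "y \<in> M"
proof -
  obtain T r where T: "finite T" "T \<subseteq> in_NR ` M" "in_NR y = (\<Sum>w\<in>T. r w *\<^sub>R w)"
    using y unfolding span_explicit by auto
  obtain f where f: "bij_betw f {0..<card T} T"
    using ex_bij_betw_nat_finite[OF T(1)] by blast
  define n where "n = card T"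
  have f': "bij_betw f {..<n} T" using f by (simp add: n_def atLeast0LessThan)
  have "\<forall>i\<in>{..<n}. \<exists>m\<in>M. f i = in_NR m" using f' T(2) by (auto simp: bij_betw_def)
  then obtain g where g: "\<And>i. i < n \<Longrightarrow> g i \<in> M" "\<And>i. i < n \<Longrightarrow> f i = in_NR (g i)"
    by (metis lessThan_iff)
  have yT: "in_NR y = (\<Sum>i<n. r (f i) *\<^sub>R in_NR (g i))"
    using sum.reindex_bij_betw[OF f', of "\<lambda>w. r w *\<^sub>R w"] g(2) by (simp add: T(3))
  define B where "B = (\<Sum>i<n. \<Sum>c\<in>UNIV. \<bar>real_of_int (g i $ c)\<bar>)"
  obtain N :: nat where N: "N > B" using reals_Archimedean2 by blast
  have "B \<ge> 0" by (simp add: B_def sum_nonneg)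
  hence N0: "N > 0" using N by (cases N) auto
  obtain q p where qp: "0 < q" "\<And>i. i < n \<Longrightarrow> \<bar>of_int q * r (f i) - of_int (p i)\<bar> < 1 / N"
    using Dirichlet_approx_simult[OF N0, of n "\<lambda>i. r (f i)"] by blast
  define m where "m = (\<Sum>i<n. p i *s g i)"
  have mM: "m \<in> M"
  proof -
    have scale: "k *s x \<in> M" if x: "x \<in> M" for k :: int and x
    proof -
      have nat: "int j *s x \<in> M" for j
        by (induction j) (use subgroup_NgrpD(1,2)[OF M] x in \<open>auto simp: vector_sadd_rdistrib\<close>)
      show ?thesis
      proof (cases "k \<ge> 0")
        case True
        thus ?thesis using nat[of "nat k"] by simp
      next
        case False
        hence "k *s x = - (int (nat (- k)) *s x)" by (simp add: vec_eq_iff)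
        thus ?thesis using subgroup_NgrpD(3)[OF M nat] by metis
      qed
    qed
    have "(\<Sum>i\<in>S. p i *s g i) \<in> M" if "S \<subseteq> {..<n}" for S
      using that by (induction S rule: infinite_finite_induct)
        (auto intro!: subgroup_NgrpD(1,2)[OF M] scale g(1))
    thus ?thesis by (simp add: m_def)
  qed
  have "(q *s y - m) $ c = 0" for c
  proof -
    have "real_of_int ((q *s y - m) $ c) = q * in_NR y $ c - (\<Sum>i<n. of_int (p i) * of_int (g i $ c))"
      by (simp add: m_def)
    also have "\<dots> = (\<Sum>i<n. (q * r (f i) - p i) * of_int (g i $ c))"
      unfolding yT by (simp add: sum_distrib_left sum_subtractf left_diff_distrib mult.assoc)
    finally have "\<bar>real_of_int ((q *s y - m) $ c)\<bar> \<le> (\<Sum>i<n. \<bar>q * r (f i) - p i\<bar> * \<bar>real_of_int (g i $ c)\<bar>)"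
      by (simp add: order_trans[OF sum_abs] abs_mult)
    also have "\<dots> \<le> (\<Sum>i<n. 1 / N * (\<Sum>c\<in>UNIV. \<bar>real_of_int (g i $ c)\<bar>))"
      using qp(2) by (intro sum_mono mult_mono) (auto intro: less_imp_le member_le_sum)
    also have "\<dots> = B / N" by (simp add: B_def sum_divide_distrib)
    also have "\<dots> < 1" using N N0 by simp
    finally show ?thesis by linarith
  qed
  hence "q *s y = m" by (simp add: vec_eq_iff)
  thus ?thesis using torsion_freeD[OF M tf qp(1)] mM by simp
qed

lemma unitary_dualD:
  assumes M: "subgroup M Ngrp" and z: "z \<in> unitary_dual M"
  shows "z (quot_map M (x + y)) = z (quot_map M x) * z (quot_map M y)"
    and "norm (z (quot_map M x)) = 1"
    and "x \<in> M \<Longrightarrow> z (quot_map M x) = 1"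
proof -
  have h: "z \<in> hom (Ngrp Mod M) Ugrp" using z by (simp add: unitary_dual_def)
  have c: "quot_map M x \<in> carrier (Ngrp Mod M)" for x by (simp add: carrier_Mod)
  have add: "z (quot_map M (x + y)) = z (quot_map M x) * z (quot_map M y)" for x y
    using hom_mult[OF h c c, of x y] by (simp add: quot_map_add[OF M] Ugrp_def)
  have n: "norm (z (quot_map M x)) = 1" for x
    using hom_in_carrier[OF h c] by (simp add: Ugrp_def)
  show "z (quot_map M (x + y)) = z (quot_map M x) * z (quot_map M y)" "norm (z (quot_map M x)) = 1"
    by (rule add, rule n)
  assume "x \<in> M"
  hence "quot_map M x = quot_map M 0" using quot_map_eq_iff[OF M, of x 0] by simp
  moreover have "z (quot_map M 0) = 1" using add[of 0 0] n[of 0] by auto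
  ultimately show "z (quot_map M x) = 1" by simp
qed

lemma unitary_dualI:
  assumes M: "subgroup M Ngrp"
    and f: "\<And>x y. f (x + y) = f x * f y" "\<And>x. norm (f x :: complex) = 1" "\<And>x. x \<in> M \<Longrightarrow> f x = 1"
  obtains w where "w \<in> unitary_dual M" "\<And>x. w (quot_map M x) = f x"
proof -
  define w where "w = restrict (\<lambda>C. f (SOME u. u \<in> C)) (carrier (Ngrp Mod M))"
  have "f x = f y" if "x - y \<in> M" for x y
    using f(1)[of "x - y" y] f(3)[OF that] by simp
  hence w: "w (quot_map M x) = f x" for x
    using descend[OF M, of f x] by (simp add: w_def carrier_Mod)
  have "w \<in> unitary_dual M"
    unfolding unitary_dual_def
  proof
    show "w \<in> hom (Ngrp Mod M) Ugrp"
      by (rule homI) (auto simp: carrier_Mod w quot_map_add[OF M] f Ugrp_def)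
    show "w \<in> extensional (carrier (Ngrp Mod M))" by (simp add: w_def)
  qed
  thus ?thesis using w that by blast
qed

lemma unitary_dual_times:
  assumes M: "subgroup M Ngrp" and wz: "w \<in> unitary_dual M" "z \<in> unitary_dual M"
  shows "(\<lambda>c\<in>carrier (Ngrp Mod M). w c * z c) \<in> unitary_dual M"
  unfolding unitary_dual_def
proof
  show "(\<lambda>c\<in>carrier (Ngrp Mod M). w c * z c) \<in> hom (Ngrp Mod M) Ugrp"
    by (rule homI)
       (auto simp: carrier_Mod quot_map_add[OF M] unitary_dualD[OF M wz(1)] unitary_dualD[OF M wz(2)] Ugrp_def norm_mult)
qed simp

text \<open>
  A point outside \<open>M\<close> lies outside the real span of \<open>M\<close> by saturation, so it has a nonzero
  component $b$ orthogonal to that span; rotate along $b$, at the speed that turns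
  \<open>y\<close> by half a circle.
\<close>

lemma separating_character:
  assumes M: "subgroup M Ngrp" and tf: "torsion_free_group (Ngrp Mod M)" and y: "y \<notin> M"
  obtains w where "w \<in> unitary_dual M" "w (quot_map M y) = - 1"
proof -
  obtain u b where ub: "u \<in> span (in_NR ` M)" "\<And>w. w \<in> span (in_NR ` M) \<Longrightarrow> orthogonal b w" "in_NR y = u + b"
    using orthogonal_subspace_decomp_exists[of "in_NR ` M" "in_NR y"] by metis
  have "b \<noteq> 0" using ub(1,3) saturated[OF M tf] y by auto
  hence b: "b \<bullet> in_NR y \<noteq> 0"
    using ub(2)[OF ub(1)] by (simp add: ub(3) inner_add_right orthogonal_def)
  define f where "f x = cis (pi * (b \<bullet> in_NR x) / (b \<bullet> in_NR y))" for x
  have "f x = 1" if "x \<in> M" for x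
    using ub(2)[of "in_NR x"] that by (simp add: f_def orthogonal_def span_base)
  moreover have "f (x + x') = f x * f x'" for x x'
    by (simp add: f_def in_NR_add inner_add_right cis_mult add_divide_distrib distrib_left)
  moreover have "norm (f x) = 1" for x by (simp add: f_def)
  ultimately obtain w where "w \<in> unitary_dual M" "\<And>x. w (quot_map M x) = f x"
    using unitary_dualI[OF M, of f] by blast
  moreover have "f y = - 1" using b by (simp add: f_def)
  ultimately show ?thesis using that by simp
qed

lemma haar_measurable:
  assumes "normalized_haar M \<mu>"
  shows "(\<lambda>z. z (quot_map M y)) \<in> borel_measurable \<mu>"
proof -
  have "(\<lambda>z. z (quot_map M y)) \<in> borel_measurable (restrict_space (\<Pi>\<^sub>M c\<in>carrier (Ngrp Mod M). borel) (unitary_dual M))"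
    by (intro measurable_restrict_space1 measurable_component_singleton) (simp add: carrier_Mod)
  moreover have "sets \<mu> = sets (restrict_space (\<Pi>\<^sub>M c\<in>carrier (Ngrp Mod M). borel) (unitary_dual M))"
    using assms by (simp add: normalized_haar_def)
  ultimately show ?thesis using measurable_cong_sets by blast
qed

lemma haar_translation_measurable:
  assumes M: "subgroup M Ngrp" and h: "normalized_haar M \<mu>" and w: "w \<in> unitary_dual M"
  shows "(\<lambda>z. \<lambda>c\<in>carrier (Ngrp Mod M). w c * z c) \<in> measurable \<mu> \<mu>"
proof -
  let ?P = "\<Pi>\<^sub>M c\<in>carrier (Ngrp Mod M). (borel :: complex measure)"
  have sets: "sets \<mu> = sets (restrict_space ?P (unitary_dual M))" and sp: "space \<mu> = unitary_dual M"
    using h by (auto simp: normalized_haar_def)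
  have "(\<lambda>z. \<lambda>c\<in>carrier (Ngrp Mod M). w c * z c) \<in> measurable \<mu> ?P"
  proof (rule measurable_restrict)
    fix c assume "c \<in> carrier (Ngrp Mod M)"
    then obtain y where "c = quot_map M y" by (auto simp: carrier_Mod)
    thus "(\<lambda>z. w c * z c) \<in> borel_measurable \<mu>" using haar_measurable[OF h, of y] by simp
  qed
  hence "(\<lambda>z. \<lambda>c\<in>carrier (Ngrp Mod M). w c * z c) \<in> measurable \<mu> (restrict_space ?P (unitary_dual M))"
    using unitary_dual_times[OF M w] by (intro measurable_restrict_space2) (auto simp: sp)
  thus ?thesis using measurable_cong_sets[OF refl sets] by blast
qed

text \<open>
  Translation by a character with value $-1$ at \<open>y\<close> shows that the integral is its own negative.
\<close>

lemma haar_orthogonality: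
  assumes M: "subgroup M Ngrp" and tf: "torsion_free_group (Ngrp Mod M)" and h: "normalized_haar M \<mu>"
  shows "(\<integral>z. z (quot_map M y) \<partial>\<mu>) = of_bool (y \<in> M)"
proof (cases "y \<in> M")
  case True
  have "(\<integral>z. z (quot_map M y) \<partial>\<mu>) = (\<integral>z. 1 \<partial>\<mu>)"
    using h unitary_dualD(3)[OF M _ True] by (intro Bochner_Integration.integral_cong) (auto simp: normalized_haar_def)
  also have "\<dots> = 1" using h by (auto simp: normalized_haar_def measure_def)
  finally show ?thesis using True by simp
next
  case False
  then obtain w where w: "w \<in> unitary_dual M" "w (quot_map M y) = - 1"
    using separating_character[OF M tf] by blast
  let ?T = "\<lambda>z. \<lambda>c\<in>carrier (Ngrp Mod M). w c * z c"
  have "(\<integral>z. z (quot_map M y) \<partial>\<mu>) = (\<integral>z. z (quot_map M y) \<partial>distr \<mu> \<mu> ?T)"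
    using h w(1) by (simp add: normalized_haar_def)
  also have "\<dots> = (\<integral>z. ?T z (quot_map M y) \<partial>\<mu>)"
    by (rule integral_distr[OF haar_translation_measurable[OF M h w(1)] haar_measurable[OF h]])
  also have "\<dots> = - (\<integral>z. z (quot_map M y) \<partial>\<mu>)"
    by (simp add: carrier_Mod w(2))
  finally have "(\<integral>z. z (quot_map M y) \<partial>\<mu>) = 0" by simp
  thus ?thesis using False by simp
qed

text \<open>
  Dominated exchange of a countable unordered sum with an integral, by transport along an enumeration to
  the theorem on series indexed by the natural numbers.
\<close>

lemma integral_infsum:
  fixes f :: "'u::countable \<Rightarrow> 'a \<Rightarrow> complex"
  assumes fin: "finite_measure \<mu>" and meas: "\<And>u. u \<in> U \<Longrightarrow> f u \<in> borel_measurable \<mu>"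
    and bound: "\<And>u z. u \<in> U \<Longrightarrow> z \<in> space \<mu> \<Longrightarrow> norm (f u z) \<le> c u"
    and c: "c summable_on U"
  shows "(\<integral>z. (\<Sum>\<^sub>\<infinity>u\<in>U. f u z) \<partial>\<mu>) = (\<Sum>\<^sub>\<infinity>u\<in>U. \<integral>z. f u z \<partial>\<mu>)"
proof -
  interpret finite_measure \<mu> by (rule fin)
  define e where "e = (\<lambda>n. from_nat n :: 'u)"
  define I where "I = (to_nat ` U :: nat set)"
  have bij: "bij_betw e I U"
    by (rule bij_betw_byWitness[where f'=to_nat]) (auto simp: e_def I_def)
  have eU: "e n \<in> U" if "n \<in> I" for n using that bij by (auto simp: bij_betw_def)
  have ext: "(\<Sum>\<^sub>\<infinity>u\<in>U. g u) = (\<Sum>n. if n \<in> I then g (e n) else 0)"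
    and exts: "summable (\<lambda>n. norm (if n \<in> I then g (e n) else 0))"
    if g: "g abs_summable_on U" for g :: "'u \<Rightarrow> complex"
  proof -
    have "((\<lambda>u. norm (g u)) has_sum (\<Sum>\<^sub>\<infinity>u\<in>U. norm (g u))) U" using g by simp
    hence "((\<lambda>n. norm (g (e n))) has_sum (\<Sum>\<^sub>\<infinity>u\<in>U. norm (g u))) I"
      by (subst has_sum_reindex_bij_betw[OF bij])
    hence "((\<lambda>n. norm (if n \<in> I then g (e n) else 0)) has_sum (\<Sum>\<^sub>\<infinity>u\<in>U. norm (g u))) UNIV"
      by (subst has_sum_cong_neutral[where T=I and g="\<lambda>n. norm (g (e n))"]) auto
    thus "summable (\<lambda>n. norm (if n \<in> I then g (e n) else 0))"
      by (blast dest: has_sum_imp_sums sums_summable)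
    have "(g has_sum (\<Sum>\<^sub>\<infinity>u\<in>U. g u)) U" using abs_summable_summable[OF g] by simp
    hence "((\<lambda>n. g (e n)) has_sum (\<Sum>\<^sub>\<infinity>u\<in>U. g u)) I"
      by (subst has_sum_reindex_bij_betw[OF bij])
    hence "((\<lambda>n. if n \<in> I then g (e n) else 0) has_sum (\<Sum>\<^sub>\<infinity>u\<in>U. g u)) UNIV"
      by (subst has_sum_cong_neutral[where T=I and g="\<lambda>n. g (e n)"]) auto
    thus "(\<Sum>\<^sub>\<infinity>u\<in>U. g u) = (\<Sum>n. if n \<in> I then g (e n) else 0)"
      by (auto dest: has_sum_imp_sums simp: sums_iff)
  qed
  have c': "(\<lambda>u. of_real (c u * k) :: complex) abs_summable_on U" for k
    using summable_on_iff_abs_summable_on_real[THEN iffD1, OF summable_on_cmult_left[OF c, of k]]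
    by (simp only: norm_of_real real_norm_def)
  have fz: "(\<lambda>u. f u z) abs_summable_on U" if "z \<in> space \<mu>" for z
  proof (rule Infinite_Sum.abs_summable_on_comparison_test[OF c'[of 1]])
    fix u assume "u \<in> U"
    thus "norm (f u z) \<le> norm (of_real (c u * 1) :: complex)" using bound[of u z] that by simp
  qed
  have int: "integrable \<mu> (f u)" if "u \<in> U" for u
    by (rule integrable_const_bound[where B="c u"]) (use that bound meas in auto)
  have norm_int: "norm (\<integral>z. f u z \<partial>\<mu>) \<le> (\<integral>z. norm (f u z) \<partial>\<mu>)" "(\<integral>z. norm (f u z) \<partial>\<mu>) \<le> c u * measure \<mu> (space \<mu>)"
    if "u \<in> U" for u
  proof -
    show "norm (\<integral>z. f u z \<partial>\<mu>) \<le> (\<integral>z. norm (f u z) \<partial>\<mu>)" by (rule integral_norm_bound)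
    have "(\<integral>z. norm (f u z) \<partial>\<mu>) \<le> (\<integral>z. c u \<partial>\<mu>)"
      using int[OF that] bound[OF that] by (intro integral_mono) auto
    thus "(\<integral>z. norm (f u z) \<partial>\<mu>) \<le> c u * measure \<mu> (space \<mu>)" by (simp add: mult.commute)
  qed
  have fi: "(\<lambda>u. of_real (\<integral>z. norm (f u z) \<partial>\<mu>) :: complex) abs_summable_on U"
  proof (rule Infinite_Sum.abs_summable_on_comparison_test[OF c'[of "measure \<mu> (space \<mu>)"]])
    fix u assume u: "u \<in> U"
    have "0 \<le> (\<integral>z. norm (f u z) \<partial>\<mu>)" by simp
    thus "norm (of_real (\<integral>z. norm (f u z) \<partial>\<mu>) :: complex) \<le> norm (of_real (c u * measure \<mu> (space \<mu>)) :: complex)"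
      using norm_int(2)[OF u] unfolding norm_of_real by linarith
  qed
  have fi': "(\<lambda>u. \<integral>z. f u z \<partial>\<mu>) abs_summable_on U"
    by (rule Infinite_Sum.abs_summable_on_comparison_test[OF fi]) (use norm_int(1) in auto)
  define F where "F n z = (if n \<in> I then f (e n) z else 0)" for n z
  have "(\<integral>z. (\<Sum>\<^sub>\<infinity>u\<in>U. f u z) \<partial>\<mu>) = (\<integral>z. (\<Sum>n. F n z) \<partial>\<mu>)"
    unfolding F_def by (intro Bochner_Integration.integral_cong refl ext fz)
  also have "\<dots> = (\<Sum>n. \<integral>z. F n z \<partial>\<mu>)"
  proof (rule integral_suminf)
    show "integrable \<mu> (F n)" for n
      using int eU by (cases "n \<in> I") (auto simp: F_def[abs_def])
    show "AE z in \<mu>. summable (\<lambda>n. norm (F n z))"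
      using exts[OF fz] by (auto simp: F_def)
    have "(\<integral>z. norm (F n z) \<partial>\<mu>) = norm (if n \<in> I then of_real (\<integral>z. norm (f (e n) z) \<partial>\<mu>) else 0 :: complex)" for n
      by (auto simp: F_def)
    thus "summable (\<lambda>n. \<integral>z. norm (F n z) \<partial>\<mu>)" using exts[OF fi] by simp
  qed
  also have "\<dots> = (\<Sum>n. if n \<in> I then (\<integral>z. f (e n) z \<partial>\<mu>) else 0)"
    by (rule suminf_cong) (simp add: F_def)
  also have "\<dots> = (\<Sum>\<^sub>\<infinity>u\<in>U. \<integral>z. f u z \<partial>\<mu>)"
    by (rule ext[OF fi', symmetric])
  finally show ?thesis .
qed

lemma (in weighted_lattice) integral_eq_G:
  assumes tf: "torsion_free_group (Ngrp Mod M)" and h: "normalized_haar M \<mu>"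
    and X: "X \<subseteq> orthant UNIV" and s: "s \<in> tube (Lam_dual_gt 0)"
  shows "(\<integral>z. (\<Sum>\<^sub>\<infinity>y\<in>orthant UNIV. a y * (z (quot_map M y) * qpow q s y)) *
              (\<Sum>\<^sub>\<infinity>x\<in>X. z (quot_map M x) * qpow q s x) \<partial>\<mu>) = G X s"
proof -
  have sp: "space \<mu> = unitary_dual M" and fin: "finite_measure \<mu>"
    using h by (auto simp: normalized_haar_def intro: finite_measureI)
  define f where "f = (\<lambda>(y, x) z. a y * qpow q s y * qpow q s x * z (quot_map M (y + x)))"
  have qX: "qpow q s abs_summable_on X"
    by (rule summable_on_subset_banach[OF summable_qpow[OF q s] X])
  have sm: "(\<lambda>(y, x). a y * qpow q s y * qpow q s x) abs_summable_on orthant UNIV \<times> X"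
    by (rule abs_summable_on_Times[OF a_summable_0[OF s] qX])
  have "(\<integral>z. (\<Sum>\<^sub>\<infinity>y\<in>orthant UNIV. a y * (z (quot_map M y) * qpow q s y)) *
              (\<Sum>\<^sub>\<infinity>x\<in>X. z (quot_map M x) * qpow q s x) \<partial>\<mu>) =
        (\<integral>z. (\<Sum>\<^sub>\<infinity>u\<in>orthant UNIV \<times> X. f u z) \<partial>\<mu>)"
  proof (rule Bochner_Integration.integral_cong[OF refl])
    fix z assume "z \<in> space \<mu>"
    hence z: "z \<in> unitary_dual M" by (simp add: sp)
    have "(\<lambda>y. a y * (z (quot_map M y) * qpow q s y)) abs_summable_on orthant UNIV"
      using a_summable_0[OF s] by (simp add: norm_mult unitary_dualD(2)[OF M z])
    moreover have "(\<lambda>x. z (quot_map M x) * qpow q s x) abs_summable_on X"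
      using qX by (simp add: norm_mult unitary_dualD(2)[OF M z])
    ultimately show "(\<Sum>\<^sub>\<infinity>y\<in>orthant UNIV. a y * (z (quot_map M y) * qpow q s y)) *
              (\<Sum>\<^sub>\<infinity>x\<in>X. z (quot_map M x) * qpow q s x) = (\<Sum>\<^sub>\<infinity>u\<in>orthant UNIV \<times> X. f u z)"
      by (subst infsum_Times) (auto intro!: infsum_cong simp: f_def unitary_dualD(1)[OF M z] mult_ac)
  qed
  also have "\<dots> = (\<Sum>\<^sub>\<infinity>u\<in>orthant UNIV \<times> X. \<integral>z. f u z \<partial>\<mu>)"
  proof (rule integral_infsum[OF fin _ _ sm])
    show "f u \<in> borel_measurable \<mu>" for u
      using haar_measurable[OF h] by (auto simp: f_def case_prod_unfold)
    show "norm (f u z) \<le> norm (case u of (y, x) \<Rightarrow> a y * qpow q s y * qpow q s x)" if "z \<in> space \<mu>" for u z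
      using that unitary_dualD(2)[OF M] by (auto simp: sp f_def norm_mult split: prod.split)
  qed
  also have "\<dots> = G X s"
    unfolding G_def
  proof (rule infsum_cong_neutral)
    have int: "(\<integral>z. f u z \<partial>\<mu>) = a (fst u) * qpow q s (fst u + snd u) * of_bool (fst u + snd u \<in> M)" for u
      using haar_orthogonality[OF M tf h, of "fst u + snd u"] q
      by (simp add: f_def case_prod_unfold qpow_add mult.assoc)
    show "(case u of (y, x) \<Rightarrow> a y * qpow q s (y + x)) = 0" if "u \<in> pairs M X - orthant UNIV \<times> X" for u
      using that by (auto simp: pairs_def)
    show "(\<integral>z. f u z \<partial>\<mu>) = 0" if "u \<in> orthant UNIV \<times> X - pairs M X" for u
      using that by (auto simp: int pairs_def)
    show "(\<integral>z. f u z \<partial>\<mu>) = (case u of (y, x) \<Rightarrow> a y * qpow q s (y + x))" if "u \<in> orthant UNIV \<times> X \<inter> pairs M X" for u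
      using that by (auto simp: int pairs_def)
  qed
  finally show ?thesis .
qed

section \<open>Finite index, rank and the theorem\<close>

text \<open>
  By Lagrange's theorem the order of the quotient by \<open>N'\<close> annihilates it.
\<close>

lemma finite_index_multiple:
  assumes "finite_index N'"
  obtains d :: int where "d > 0" "\<And>x. d *s x \<in> N'"
proof -
  have N': "subgroup N' Ngrp" and fin: "finite (carrier (Ngrp Mod N'))"
    using assms by (auto simp: finite_index_def FactGroup_def)
  interpret Q: group "Ngrp Mod N'"
    by (rule normal.factorgroup_is_group[OF normal_Ngrp[OF N']])
  have "int (order (Ngrp Mod N')) *s x \<in> N'" for x
  proof -
    have "quot_map N' x [^]\<^bsub>Ngrp Mod N'\<^esub> order (Ngrp Mod N') = \<one>\<^bsub>Ngrp Mod N'\<^esub>"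
      by (rule Q.pow_order_eq_1) (simp add: carrier_Mod)
    thus ?thesis
      using quot_map_eq_iff[OF N', of "int (order (Ngrp Mod N')) *s x" 0]
      by (simp add: quot_map_pow[OF N'] one_Mod quot_map_0)
  qed
  moreover have "order (Ngrp Mod N') > 0" using fin Q.order_gt_0_iff_finite by blast
  ultimately show ?thesis using that[of "int (order (Ngrp Mod N'))"] by simp
qed

text \<open>
  Reduction modulo \<open>d\<close> sorts the points of \<open>N'\<close> in the face into finitely many boxes, since
  \<open>N'\<close> is stable under translation by multiples of \<open>d\<close>.
\<close>

lemma (in weighted_lattice) G_finite_index:
  assumes N': "subgroup N' Ngrp" and d: "d > 0" "\<And>x. d *s x \<in> N'"
  shows "cone_sum q (M \<inter> (*s) d ` orthant J) (G (N' \<inter> orthant J))"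
proof -
  define R where "R = {v \<in> N' \<inter> orthant J. \<forall>i. v $ i < d}"
  have "finite R"
  proof (rule finite_subset)
    show "R \<subseteq> (\<lambda>f. \<chi> i. f i) ` (PiE UNIV (\<lambda>_. {0..<d}))"
    proof
      fix v assume "v \<in> R"
      hence "v = (\<chi> i. v $ i)" "(\<lambda>i. v $ i) \<in> PiE UNIV (\<lambda>_. {0..<d})"
        by (auto simp: R_def orthant_def)
      thus "v \<in> (\<lambda>f. \<chi> i. f i) ` (PiE UNIV (\<lambda>_. {0..<d}))" by blast
    qed
    show "finite ((\<lambda>f. \<chi> i. f i) ` (PiE UNIV (\<lambda>_. {0..<d})) :: (int ^ 'i) set)"
      by (intro finite_imageI finite_PiE) auto
  qed
  have md: "x $ i mod d = v $ i" if "v \<in> R" "x \<in> dbox d v J" for v x i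
  proof -
    obtain k where "x = v + d *s k" using \<open>x \<in> dbox d v J\<close> by (auto simp: dbox_def)
    moreover have "0 \<le> v $ i" "v $ i < d" using \<open>v \<in> R\<close> by (auto simp: R_def orthant_def)
    ultimately show ?thesis by simp
  qed
  have Un: "N' \<inter> orthant J = (\<Union>v\<in>R. dbox d v J)"
  proof (intro equalityI subsetI)
    fix x assume x: "x \<in> N' \<inter> orthant J"
    define v k :: "int ^ 'i" where "v = (\<chi> i. x $ i mod d)" and "k = (\<chi> i. x $ i div d)"
    have xv: "x = v + d *s k" by (simp add: v_def k_def vec_eq_iff)
    have "v = x - d *s k" using xv by simp
    hence "v \<in> N'" using x subgroup_NgrpD(4)[OF N' _ d(2)] by simp
    moreover have "v \<in> orthant J" "k \<in> orthant J"
      using x d(1) by (auto simp: v_def k_def orthant_def pos_imp_zdiv_nonneg_iff)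
    moreover have "v $ i < d" for i using d(1) by (simp add: v_def)
    moreover have "v + d *s k \<in> dbox d v J" unfolding dbox_def using \<open>k \<in> orthant J\<close> by (rule imageI)
    ultimately have "v \<in> R" "x \<in> dbox d v J" unfolding xv[symmetric] by (simp_all add: R_def)
    thus "x \<in> (\<Union>v\<in>R. dbox d v J)" by blast
  next
    fix x assume "x \<in> (\<Union>v\<in>R. dbox d v J)"
    then obtain v k where "v \<in> R" "k \<in> orthant J" "x = v + d *s k" by (auto simp: dbox_def)
    thus "x \<in> N' \<inter> orthant J"
      using subgroup_NgrpD(2)[OF N' _ d(2)] d(1) by (auto simp: R_def orthant_def)
  qed
  have Ro: "R \<subseteq> orthant UNIV" by (auto simp: R_def orthant_def)
  have "G (\<Union>v\<in>S. dbox d v J) s = (\<Sum>v\<in>S. G (dbox d v J) s)"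
    if "finite S" "S \<subseteq> R" "s \<in> tube (Lam_dual_gt 0)" for S s
    using that(1,2)
  proof (induction S rule: finite_induct)
    case empty
    show ?case by (simp add: G_def pairs_def)
  next
    case (insert v S)
    have "dbox d v J \<inter> (\<Union>v\<in>S. dbox d v J) = {}"
    proof (rule ccontr)
      assume "dbox d v J \<inter> (\<Union>v\<in>S. dbox d v J) \<noteq> {}"
      then obtain x v' where "x \<in> dbox d v J" "x \<in> dbox d v' J" "v' \<in> S" by blast
      hence "v = v'" using md[of v x] md[of v' x] insert.prems by (auto simp: vec_eq_iff)
      thus False using insert.hyps \<open>v' \<in> S\<close> by simp
    qed
    moreover have "dbox d v J \<subseteq> orthant UNIV" "(\<Union>v\<in>S. dbox d v J) \<subseteq> orthant UNIV"
      using dbox_subset[of d] d(1) insert.prems Ro by (auto simp: subset_iff)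
    ultimately show ?case
      using insert that(3) by (simp add: G_Un)
  qed
  from this[OF \<open>finite R\<close> subset_refl]
  have "G (N' \<inter> orthant J) s = (\<Sum>v\<in>R. G (dbox d v J) s)" if "s \<in> tube (Lam_dual_gt 0)" for s
    using that by (simp add: Un)
  moreover have "cone_sum q (M \<inter> (*s) d ` orthant J) (\<lambda>s. \<Sum>v\<in>R. G (dbox d v J) s)"
    using Ro by (intro cone_sum_sum G_cone_sum d(1)) auto
  ultimately show ?thesis by (rule cone_sum_cong[rotated])
qed

text \<open>
  A coordinate form that vanishes on \<open>M\<close> would descend to a nonzero element of
  $\Gamma^\vee \cap \Lambda^\vee$.
\<close>

lemma coordinate_nonvanishing:
  assumes M: "subgroup M Ngrp" and dual: "dual_quot M \<inter> dual_cone Lam = {0}"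
  shows "\<exists>m\<in>M. m $ c \<noteq> 0"
proof (rule ccontr)
  assume "\<not> (\<exists>m\<in>M. m $ c \<noteq> 0)"
  hence zero: "m $ c = 0" if "m \<in> M" for m using that by blast
  define \<phi> where "\<phi> C = (SOME u. u \<in> C) $ c" for C :: "(int ^ 'a) set"
  have "x $ c = y $ c" if "x - y \<in> M" for x y
    using zero[OF that] by simp
  hence \<phi>: "\<phi> (quot_map M x) = x $ c" for x
    unfolding \<phi>_def using descend[OF M, of "\<lambda>x. x $ c" x] by blast
  have "\<phi> \<in> hom (Ngrp Mod M) integer_group"
    by (rule homI) (auto simp: carrier_Mod \<phi> quot_map_add[OF M] integer_group_def)
  hence "(\<chi> i. of_int (\<phi> (quot_map M (axis i 1)))) \<in> dual_quot M"
    unfolding dual_quot_def by blast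
  also have "(\<chi> i. of_int (\<phi> (quot_map M (axis i 1)))) = (axis c 1 :: real ^ 'a)"
    by (simp add: \<phi> vec_eq_iff axis_def)
  finally have "axis c 1 \<in> dual_quot M" .
  moreover have "axis c 1 \<in> dual_cone (Lam :: (real ^ 'a) set)"
    using coordinate_cone[of UNIV] by (auto simp: dual_cone_def Lam_def inner_axis')
  ultimately have "axis c 1 = (0 :: real ^ 'a)" using dual by blast
  thus False by (simp add: axis_eq_0_iff)
qed

lemma dim_face:
  assumes "F \<subseteq> M" "\<And>x. x \<in> F \<Longrightarrow> x $ c = 0" "m \<in> M" "m $ c \<noteq> 0"
  shows "dim (in_NR ` F) < subgroup_rank M"
proof -
  have "subspace {x :: real ^ 'a. x $ c = 0}" by (auto simp: subspace_def)
  hence "span (in_NR ` F) \<subseteq> {x. x $ c = 0}"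
    using assms(2) by (intro span_minimal) auto
  hence "in_NR m \<notin> span (in_NR ` F)" using assms(4) by auto
  moreover have "in_NR m \<in> span (in_NR ` M)" using assms(3) by (intro span_base) auto
  moreover have "span (in_NR ` F) \<subseteq> span (in_NR ` M)" using assms(1) by (intro span_mono) auto
  ultimately have "span (in_NR ` F) \<subset> span (in_NR ` M)" by blast
  thus ?thesis by (simp add: subgroup_rank_def dim_psubset)
qed

theorem mainTheorem4:
  fixes q :: nat
    and M N' :: "(int ^ 'i) set"
    and J :: "'i set"
    and a :: "int ^ 'i \<Rightarrow> complex"
    and \<epsilon> :: real
    and \<mu> :: "((int ^ 'i) set \<Rightarrow> complex) measure"
    and f3 :: "complex ^ 'i \<Rightarrow> complex"
  assumes q: "q = CARD('k::{finite, field})"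
    and M: "subgroup M Ngrp"
    and torsion_free: "torsion_free_group (Ngrp Mod M)"
    and N': "finite_index N'"
    and J: "J \<subset> UNIV"
    and eps: "0 < \<epsilon>"
    and a: "\<And>s. s \<in> tube (Lam_dual_gt (- \<epsilon>)) \<Longrightarrow> Lser_converges UNIV Lam a (qpow q s)"
    and haar: "normalized_haar M \<mu>"
    and f3: "\<And>s. s \<in> tube (Lam_dual_gt 0) \<Longrightarrow>
      f3 s = (\<integral>z. Lser UNIV Lam a (\<lambda>y. z (quot_map M y) * qpow q s y) *
                   Lser N' (cone_gen ((\<lambda>i. axis i 1) ` J)) (\<lambda>_. 1)
                     (\<lambda>y. z (quot_map M y) * qpow q s y) \<partial>\<mu>)"
    and dual: "dual_quot M \<inter> dual_cone Lam = {0}"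
  shows "admissible q (1 - int (subgroup_rank M)) f3"
proof -
  have "card {0, 1 :: 'k} \<le> CARD('k)" by (intro card_mono) auto
  hence q1: "q > 1" by (simp add: q)
  interpret weighted_lattice q M a \<epsilon>
    by (rule weighted_lattice.intro[OF q1 M eps a])
  obtain d :: int where d: "d > 0" "\<And>x. d *s x \<in> N'"
    using finite_index_multiple[OF N'] by blast
  have N'_sub: "subgroup N' Ngrp" using N' by (simp add: finite_index_def)
  have "f3 s = G (N' \<inter> orthant J) s" if "s \<in> tube (Lam_dual_gt 0)" for s
    unfolding f3[OF that] Lser_def lattice_pts_Lam lattice_pts_coordinate mult_1
    using orthant_mono[of J UNIV] by (intro integral_eq_G torsion_free haar that) auto
  with G_finite_index[OF N'_sub d, of J]
  have sum: "cone_sum q (M \<inter> (*s) d ` orthant J) f3"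
    by (rule cone_sum_cong)
  obtain c where c: "c \<notin> J" using J by blast
  obtain m where m: "m \<in> M" "m $ c \<noteq> 0" using coordinate_nonvanishing[OF M dual] by blast
  have face: "dim (in_NR ` F) < subgroup_rank M" if "F \<subseteq> M \<inter> (*s) d ` orthant J" for F
    using that c m by (intro dim_face[of F M c m]) (auto simp: orthant_def)
  have "admissible q (- int (subgroup_rank M - 1)) f3"
  proof (rule cone_sum_admissible[OF sum q1])
    show "M \<inter> (*s) d ` orthant J \<subseteq> orthant UNIV"
      using d(1) by (auto simp: orthant_def)
    show "dim (in_NR ` F) \<le> subgroup_rank M - 1" if "F \<subseteq> M \<inter> (*s) d ` orthant J" for F
      using face[OF that] by simp
  qed
  \<comment> \<open>Positivity of the rank makes the truncated subtraction above an honest one.\<close>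
  moreover have "subgroup_rank M > 0" using face[of "{}"] by simp
  ultimately show ?thesis by (simp add: of_nat_diff)
qed

end
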